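(* Let $\mathcal{D}$ be the set of linear partial differential operators with constant coefficients, i.e. operators of the form $D=\sum_{\alpha\in\mathbb{N}^n}a_\alpha\frac{\partial^{|\alpha|}}{\partial x^\alpha}$ for some $n\in\mathbb{N}$ with $a_\alpha\in\mathbb{R}$ and only finitely many $a_\alpha$ non-zero (acting on smooth functions $\mathbb{R}^m\to\mathbb{R}$, $m\ge n$). Then $(\mathcal{D},\circ,\mathrm{id})$, with $\circ$ composition of operators and $\mathrm{id}$ the identity operator, is a monoid which is additive splitting: for all $D_1,D_2,D_3,D_4\in\mathcal{D}$ with $D_1\circ D_2=D_3\circ D_4$, there exist $D_{1,3},D_{1,4},D_{2,3},D_{2,4}\in\mathcal{D}$ such that $D_1=D_{1,3}\circ D_{1,4}$, $D_2=D_{2,3}\circ D_{2,4}$, $D_3=D_{1,3}\circ D_{2,3}$ and $D_4=D_{1,4}\circ D_{2,4}$.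
   Context: Here $\frac{\partial^{|\alpha|}}{\partial x^\alpha}=\frac{\partial^{\alpha_1}}{\partial x_1^{\alpha_1}}\cdots\frac{\partial^{\alpha_n}}{\partial x_n^{\alpha_n}}$ and $|\alpha|=\alpha_1+\dots+\alpha_n$; operators in fewer variables are regarded as operators in more variables via the inclusion $C^\infty(\mathbb{R}^n,\mathbb{R})\subseteq C^\infty(\mathbb{R}^m,\mathbb{R})$ for $m\ge n$. *)

theory Defs
  imports "HOL-Analysis.Analysis" "HOL-Algebra.Group"
begin

text \<open>
  A function on \<open>\<real>\<^sup>m\<close> is represented as a function on real sequences that depends only on the
  coordinates \<open>0, \<dots>, m - 1\<close>, so that the inclusion of \<open>C\<^sup>\<infinity>(\<real>\<^sup>n)\<close> into \<open>C\<^sup>\<infinity>(\<real>\<^sup>m)\<close> for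
  \<open>n \<le> m\<close> is inclusion of sets. The mathematical variable \<open>x\<^sub>i\<close> is coordinate \<open>i - 1\<close>.
\<close>

type_synonym real_fun = "(nat \<Rightarrow> real) \<Rightarrow> real"

definition partial_deriv :: "nat \<Rightarrow> real_fun \<Rightarrow> real_fun" where
  "partial_deriv i f = (\<lambda>x. deriv (\<lambda>t. f (x(i := t))) (x i))"

definition partial_differentiable :: "nat \<Rightarrow> real_fun \<Rightarrow> bool" where
  "partial_differentiable i f \<longleftrightarrow>
     (\<forall>x. (\<lambda>t. f (x(i := t))) differentiable (at (x i)))"

definition depends_on_first :: "nat \<Rightarrow> real_fun \<Rightarrow> bool" where
  "depends_on_first m f \<longleftrightarrow> (\<forall>x y. (\<forall>i<m. x i = y i) \<longrightarrow> f x = f y)"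

text \<open>
  \<open>C_infinity m\<close> is \<open>C\<^sup>\<infinity>(\<real>\<^sup>m, \<real>)\<close>: the partial derivatives of all orders exist and are
  continuous. Sequences carry the product topology; for functions of the first \<open>m\<close>
  coordinates, continuity in it is continuity on \<open>\<real>\<^sup>m\<close>.
\<close>

definition C_infinity :: "nat \<Rightarrow> real_fun set" where
  "C_infinity m = {f. depends_on_first m f \<and>
     (\<forall>is. set is \<subseteq> {..<m} \<longrightarrow>
        continuous_on UNIV (foldr partial_deriv is f) \<and>
        (\<forall>i<m. partial_differentiable i (foldr partial_deriv is f)))}"

definition smooth_functions :: "real_fun set" where
  "smooth_functions = (\<Union>m. C_infinity m)"

definition multi_indices :: "nat \<Rightarrow> (nat \<Rightarrow> nat) set" where
  "multi_indices n = {\<alpha>. \<forall>i\<ge>n. \<alpha> i = 0}"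

text \<open>
  The derivative of multi-index \<open>\<alpha>\<close> in the first \<open>n\<close> variables, the last variable being
  differentiated first.
\<close>

primrec mixed_deriv :: "nat \<Rightarrow> (nat \<Rightarrow> nat) \<Rightarrow> real_fun \<Rightarrow> real_fun" where
  "mixed_deriv 0 \<alpha> f = f"
| "mixed_deriv (Suc n) \<alpha> f = mixed_deriv n \<alpha> ((partial_deriv n ^^ \<alpha> n) f)"

text \<open>
  Operators are extensional functions on the union of all \<open>C\<^sup>\<infinity>(\<real>\<^sup>m, \<real>)\<close>. An operator in \<open>n\<close>
  variables acts on \<open>C\<^sup>\<infinity>(\<real>\<^sup>m, \<real>)\<close> for \<open>m < n\<close> through the inclusion into \<open>C\<^sup>\<infinity>(\<real>\<^sup>n, \<real>)\<close>, so two
  operators are equal iff they agree on \<open>C\<^sup>\<infinity>(\<real>\<^sup>m, \<real>)\<close> for all large \<open>m\<close>.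
\<close>

definition diff_operator ::
  "nat \<Rightarrow> ((nat \<Rightarrow> nat) \<Rightarrow> real) \<Rightarrow> real_fun \<Rightarrow> real_fun" where
  "diff_operator n a =
     (\<lambda>f \<in> smooth_functions. \<lambda>x. \<Sum>\<alpha> | a \<alpha> \<noteq> 0. a \<alpha> * mixed_deriv n \<alpha> f x)"

definition diff_operators :: "(real_fun \<Rightarrow> real_fun) set" where
  "diff_operators =
     {diff_operator n a | n a. finite {\<alpha>. a \<alpha> \<noteq> 0} \<and> {\<alpha>. a \<alpha> \<noteq> 0} \<subseteq> multi_indices n}"

definition diff_operator_monoid :: "(real_fun \<Rightarrow> real_fun) monoid" where
  "diff_operator_monoid =
     \<lparr>carrier = diff_operators,
      mult = (\<lambda>D\<^sub>1 D\<^sub>2. compose smooth_functions D\<^sub>1 D\<^sub>2),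
      one = (\<lambda>f \<in> smooth_functions. f)\<rparr>"

definition additive_splitting :: "('a, 'b) monoid_scheme \<Rightarrow> bool" where
  "additive_splitting G \<longleftrightarrow>
     (\<forall>d\<^sub>1 \<in> carrier G. \<forall>d\<^sub>2 \<in> carrier G. \<forall>d\<^sub>3 \<in> carrier G. \<forall>d\<^sub>4 \<in> carrier G.
        d\<^sub>1 \<otimes>\<^bsub>G\<^esub> d\<^sub>2 = d\<^sub>3 \<otimes>\<^bsub>G\<^esub> d\<^sub>4 \<longrightarrow>
        (\<exists>d\<^sub>1\<^sub>3 \<in> carrier G. \<exists>d\<^sub>1\<^sub>4 \<in> carrier G. \<exists>d\<^sub>2\<^sub>3 \<in> carrier G. \<exists>d\<^sub>2\<^sub>4 \<in> carrier G.
           d\<^sub>1 = d\<^sub>1\<^sub>3 \<otimes>\<^bsub>G\<^esub> d\<^sub>1\<^sub>4 \<and> d\<^sub>2 = d\<^sub>2\<^sub>3 \<otimes>\<^bsub>G\<^esub> d\<^sub>2\<^sub>4 \<and>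
           d\<^sub>3 = d\<^sub>1\<^sub>3 \<otimes>\<^bsub>G\<^esub> d\<^sub>2\<^sub>3 \<and> d\<^sub>4 = d\<^sub>1\<^sub>4 \<otimes>\<^bsub>G\<^esub> d\<^sub>2\<^sub>4))"

end

theory Submission
  imports Defs "HOL-Library.Poly_Mapping" "HOL-Computational_Algebra.Polynomial"
begin

text \<open>
  Since partial derivatives of smooth functions commute, mapping a real polynomial in countably many
  variables to the operator obtained by substituting \<open>\<partial>/\<partial>x\<^sub>i\<close> for the variables turns products into
  compositions. It is injective: an operator multiplies the exponential \<open>exp (\<Sum>i<m. t i * x i)\<close>
  by the value of its polynomial at \<open>t\<close>. The claim thus reduces to the ring of polynomials, where
  \<open>a * b = c * d\<close> with \<open>a \<noteq> 0\<close> is split by distributing the prime factors of \<open>a\<close> over \<open>c\<close> and \<open>d\<close>;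
  if \<open>a = 0\<close>, then \<open>c = 0\<close> or \<open>d = 0\<close> and a splitting is explicit. Prime factorizations exist in
  finitely many variables by Gauss's lemma and induction on the number of variables. As this number
  cannot be a type parameter in the induction, the polynomials in the first \<open>n\<close> variables are subsets
  of a single ring, and divisibility and primality are taken relative to a subring.
\<close>

section \<open>Unique factorization in polynomial rings over subrings\<close>

text \<open>The cofactor must lie in \<open>S\<close>. With cofactors from the ambient ring, more
  elements could be units, and the notion would belong to the type instead of the subring.\<close>

definition dvd_in :: "'a::comm_ring_1 set \<Rightarrow> 'a \<Rightarrow> 'a \<Rightarrow> bool" where
  "dvd_in S a b \<longleftrightarrow> (\<exists>c\<in>S. b = a * c)"

definition prime_in :: "'a::comm_ring_1 set \<Rightarrow> 'a \<Rightarrow> bool" where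
  "prime_in S p \<longleftrightarrow> p \<in> S \<and> p \<noteq> 0 \<and> \<not> dvd_in S p 1 \<and>
     (\<forall>a\<in>S. \<forall>b\<in>S. dvd_in S p (a * b) \<longrightarrow> dvd_in S p a \<or> dvd_in S p b)"

text \<open>Factorizations are built by prepending one prime to a product that ends in a unit, so
  facts about them follow by rule induction, without lists or multisets of factors.\<close>

inductive_set prime_products :: "'a::comm_ring_1 set \<Rightarrow> 'a set" for S where
  unit: "u \<in> S \<Longrightarrow> dvd_in S u 1 \<Longrightarrow> u \<in> prime_products S"
| prime: "prime_in S p \<Longrightarrow> a \<in> prime_products S \<Longrightarrow> p * a \<in> prime_products S"

text \<open>Existence alone characterizes factorial domains here, because the factors are prime and
  not merely irreducible; uniqueness up to units is then automatic.\<close>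

definition ufd_on :: "'a::comm_ring_1 set \<Rightarrow> bool" where
  "ufd_on S \<longleftrightarrow> (\<forall>a\<in>S. a \<noteq> 0 \<longrightarrow> a \<in> prime_products S)"

definition polys_over :: "'a::comm_ring_1 set \<Rightarrow> 'a poly set" where
  "polys_over S = {p. \<forall>i. coeff p i \<in> S}"

lemma dvd_inI: "c \<in> S \<Longrightarrow> b = a * c \<Longrightarrow> dvd_in S a b"
  by (auto simp: dvd_in_def)

lemma dvd_inE: "dvd_in S a b \<Longrightarrow> (\<And>c. c \<in> S \<Longrightarrow> b = a * c \<Longrightarrow> thesis) \<Longrightarrow> thesis"
  by (auto simp: dvd_in_def)

section \<open>Divisibility and products of primes in a subring of a domain\<close>

locale idom_subring =
  fixes S :: "'a::idom set"
  assumes one_closed [simp, intro]: "1 \<in> S"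
    and add_closed [simp, intro]: "a \<in> S \<Longrightarrow> b \<in> S \<Longrightarrow> a + b \<in> S"
    and uminus_closed [simp, intro]: "a \<in> S \<Longrightarrow> - a \<in> S"
    and mult_closed [simp, intro]: "a \<in> S \<Longrightarrow> b \<in> S \<Longrightarrow> a * b \<in> S"
begin

lemma zero_closed [simp, intro]: "0 \<in> S"
  using add_closed[OF one_closed uminus_closed[OF one_closed]] by simp

lemma diff_closed [simp, intro]: "a \<in> S \<Longrightarrow> b \<in> S \<Longrightarrow> a - b \<in> S"
  using add_closed[of a "- b"] by simp

lemma power_closed [simp, intro]: "a \<in> S \<Longrightarrow> a ^ n \<in> S"
  by (induction n) auto

lemma sum_closed [intro]: "(\<And>i. i \<in> I \<Longrightarrow> f i \<in> S) \<Longrightarrow> sum f I \<in> S"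
  by (induction I rule: infinite_finite_induct) auto

lemma dvd_in_refl [simp]: "dvd_in S a a"
  by (rule dvd_inI[of 1]) auto

lemma dvd_in_trans: "dvd_in S a b \<Longrightarrow> dvd_in S b c \<Longrightarrow> dvd_in S a c"
  by (auto simp: dvd_in_def mult.assoc)

lemma dvd_in_mult: "dvd_in S a b \<Longrightarrow> c \<in> S \<Longrightarrow> dvd_in S a (b * c)"
  by (auto simp: dvd_in_def mult.assoc)

lemma dvd_in_mult2: "dvd_in S a b \<Longrightarrow> c \<in> S \<Longrightarrow> dvd_in S a (c * b)"
  using dvd_in_mult by (simp add: mult.commute)

lemma dvd_in_add: "dvd_in S a b \<Longrightarrow> dvd_in S a c \<Longrightarrow> dvd_in S a (b + c)"
  by (elim dvd_inE, rule dvd_inI[OF add_closed]) (auto simp: distrib_left)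

lemma dvd_in_diff: "dvd_in S a b \<Longrightarrow> dvd_in S a c \<Longrightarrow> dvd_in S a (b - c)"
  by (elim dvd_inE, rule dvd_inI[OF diff_closed]) (auto simp: right_diff_distrib)

lemma dvd_in_sum: "(\<And>i. i \<in> I \<Longrightarrow> dvd_in S a (f i)) \<Longrightarrow> dvd_in S a (sum f I)"
  by (induction I rule: infinite_finite_induct) (auto intro: dvd_in_add dvd_inI[of 0])

lemma prime_products_closed: "a \<in> prime_products S \<Longrightarrow> a \<in> S"
  by (induction rule: prime_products.induct) (auto simp: prime_in_def)

lemma prime_products_mult:
  assumes "a \<in> prime_products S" "b \<in> prime_products S"
  shows "a * b \<in> prime_products S"
  using assms(1)
proof induction
  case (unit u)
  from assms(2) show ?case
  proof (induction)
    case (unit v)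
    with \<open>dvd_in S u 1\<close> obtain u' v' where "u' \<in> S" "v' \<in> S" "1 = u * u'" "1 = v * v'"
      by (auto elim!: dvd_inE)
    moreover from this have "1 = (u * v) * (u' * v')" by (metis mult.assoc mult.commute mult_1)
    ultimately show ?case using \<open>u \<in> S\<close> \<open>v \<in> S\<close>
      by (intro prime_products.unit dvd_inI[of "u' * v'"]) auto
  next
    case (prime p a)
    then show ?case using prime_products.prime[of S p "u * a"] by (simp add: mult.left_commute)
  qed
next
  case (prime p a)
  then show ?case using prime_products.prime[of S p "a * b"] by (simp add: mult.assoc)
qed

text \<open>Induction on the factorization of the first factor. A prime in it divides
  \<open>c\<close> or \<open>d\<close>; it is cancelled there, the remaining equation is split, and
  the prime is put back into the part shared by the first factor and \<open>c\<close>, or by the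
  first factor and \<open>d\<close>.\<close>

theorem prime_products_refinement:
  assumes "a \<in> prime_products S" "b \<in> S" "c \<in> S" "d \<in> S" "a * b = c * d"
  shows "\<exists>e\<in>S. \<exists>f\<in>S. \<exists>g\<in>S. \<exists>h\<in>S. a = e * f \<and> b = g * h \<and> c = e * g \<and> d = f * h"
  using assms
proof (induction arbitrary: c d)
  case (unit u)
  then obtain v where v: "v \<in> S" "u * v = 1" by (metis dvd_in_def)
  have "b = v * (u * b)" using v by (metis mult.assoc mult.commute mult_1)
  also have "\<dots> = (v * c) * d" using unit by (simp add: mult.assoc)
  finally have "b = (v * c) * d" .
  moreover have "c = u * (v * c)" using v by (simp add: mult.assoc[symmetric])
  \<comment> \<open>A unit can be given wholly to \<open>c\<close>: the first factor is
    \<open>u * 1\<close>, and its inverse \<open>v\<close> is absorbed into the part shared by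
    \<open>b\<close> and \<open>c\<close>.\<close>
  ultimately show ?case using unit v by (intro bexI[of _ u] bexI[of _ 1] bexI[of _ "v * c"] bexI[of _ d]) auto
next
  case (prime p a)
  have aS: "a \<in> S" using prime prime_products_closed by blast
  have p: "p \<in> S" "p \<noteq> 0" using prime(1) by (auto simp: prime_in_def)
  have "dvd_in S p (c * d)" using prime aS by (metis dvd_inI mult.assoc mult_closed)
  then consider c' where "c' \<in> S" "c = p * c'" | d' where "d' \<in> S" "d = p * d'"
    using prime unfolding prime_in_def dvd_in_def by blast
  then show ?case
  proof cases
    case 1
    then have "a * b = c' * d" using prime p by (simp add: mult.assoc)
    then obtain e f g h where "e \<in> S" "f \<in> S" "g \<in> S" "h \<in> S" "a = e * f" "b = g * h" "c' = e * g" "d = f * h"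
      using prime.IH[of c' d] 1 prime.prems by blast
    then show ?thesis using 1 p
      by (intro bexI[of _ "p * e"] bexI[of _ f] bexI[of _ g] bexI[of _ h]) (auto simp: mult.assoc)
  next
    case 2
    then have "p * (a * b) = p * (c * d')" using prime.prems by (simp add: ac_simps)
    then have "a * b = c * d'" using p by simp
    then obtain e f g h where "e \<in> S" "f \<in> S" "g \<in> S" "h \<in> S" "a = e * f" "b = g * h" "c = e * g" "d' = f * h"
      using prime.IH[of c d'] 2 prime.prems by blast
    then show ?thesis using 2 p
      by (intro bexI[of _ e] bexI[of _ "p * f"] bexI[of _ g] bexI[of _ h]) (auto simp: ac_simps)
  qed
qed

section \<open>Constants in the polynomial ring and Gauss's lemma\<close>

lemma idom_subring_polys_over: "idom_subring (polys_over S)"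
  by unfold_locales (auto simp: polys_over_def coeff_mult coeff_1 intro!: sum_closed)

interpretation poly: idom_subring "polys_over S"
  by (rule idom_subring_polys_over)

lemma const_polys_over [simp]: "[:c:] \<in> polys_over S \<longleftrightarrow> c \<in> S"
  by (auto simp: polys_over_def coeff_pCons split: nat.splits dest: spec[of _ 0])

lemma monom_polys_over [simp]: "c \<in> S \<Longrightarrow> monom c n \<in> polys_over S"
  by (auto simp: polys_over_def)

lemma smult_polys_over [simp]: "c \<in> S \<Longrightarrow> p \<in> polys_over S \<Longrightarrow> smult c p \<in> polys_over S"
  by (auto simp: polys_over_def)

lemma lead_coeff_closed: "p \<in> polys_over S \<Longrightarrow> lead_coeff p \<in> S"
  by (auto simp: polys_over_def)

lemma const_dvd_in_iff:
  assumes "c \<in> S"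
  shows "dvd_in (polys_over S) [:c:] p \<longleftrightarrow> (\<forall>i. dvd_in S c (coeff p i))"
proof
  assume "dvd_in (polys_over S) [:c:] p"
  then show "\<forall>i. dvd_in S c (coeff p i)" by (auto simp: dvd_in_def polys_over_def)
next
  assume "\<forall>i. dvd_in S c (coeff p i)"
  then show "dvd_in (polys_over S) [:c:] p"
  proof (induction p)
    case 0
    then show ?case by (auto simp: dvd_in_def intro!: bexI[of _ 0])
  next
    case (pCons a p)
    have "dvd_in S c (coeff p i)" for i using pCons.prems[rule_format, of "Suc i"] by simp
    with pCons.IH obtain q where q: "q \<in> polys_over S" "p = [:c:] * q" by (auto elim: dvd_inE)
    obtain b where b: "b \<in> S" "a = c * b" using pCons.prems[rule_format, of 0] by (auto elim: dvd_inE)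
    have "pCons b q \<in> polys_over S" using q b by (auto simp: polys_over_def coeff_pCons split: nat.splits)
    moreover have "pCons a p = [:c:] * pCons b q" using q b by simp
    ultimately show ?case by (rule dvd_inI)
  qed
qed

text \<open>Gauss's lemma. If \<open>c\<close> divides neither \<open>a\<close> nor
  \<open>b\<close>, let \<open>i\<close> and \<open>j\<close> be the least indices of coefficients
  that \<open>c\<close> does not divide. In coefficient \<open>i + j\<close> of the product every
  other summand is divisible by \<open>c\<close>, so \<open>c\<close> divides
  \<open>coeff a i * coeff b j\<close>, contradicting primality.\<close>

lemma prime_in_const:
  assumes "prime_in S c"
  shows "prime_in (polys_over S) [:c:]"
  unfolding prime_in_def
proof (intro conjI ballI impI)
  have c: "c \<in> S" "c \<noteq> 0" "\<not> dvd_in S c 1" using assms by (auto simp: prime_in_def)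
  show "[:c:] \<in> polys_over S" "[:c:] \<noteq> 0" using c by auto
  show "\<not> dvd_in (polys_over S) [:c:] 1"
    unfolding const_dvd_in_iff[OF c(1)] using c(3) by (auto dest: spec[of _ 0])
  fix a b assume ab: "a \<in> polys_over S" "b \<in> polys_over S" "dvd_in (polys_over S) [:c:] (a * b)"
  show "dvd_in (polys_over S) [:c:] a \<or> dvd_in (polys_over S) [:c:] b"
  proof (rule ccontr)
    assume "\<not> ?thesis"
    then have ex: "\<exists>i. \<not> dvd_in S c (coeff a i)" "\<exists>i. \<not> dvd_in S c (coeff b i)"
      unfolding const_dvd_in_iff[OF c(1)] by auto
    define i where "i = (LEAST i. \<not> dvd_in S c (coeff a i))"
    define j where "j = (LEAST i. \<not> dvd_in S c (coeff b i))"
    have i: "\<not> dvd_in S c (coeff a i)" "\<And>k. k < i \<Longrightarrow> dvd_in S c (coeff a k)"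
      unfolding i_def using LeastI_ex[OF ex(1)] not_less_Least by auto
    have j: "\<not> dvd_in S c (coeff b j)" "\<And>k. k < j \<Longrightarrow> dvd_in S c (coeff b k)"
      unfolding j_def using LeastI_ex[OF ex(2)] not_less_Least by auto
    have S: "coeff a k \<in> S" "coeff b k \<in> S" for k using ab by (auto simp: polys_over_def)
    have "dvd_in S c (coeff (a * b) (i + j))" using ab c const_dvd_in_iff by blast
    moreover have "coeff (a * b) (i + j) = coeff a i * coeff b j +
        (\<Sum>k\<in>{..i+j} - {i}. coeff a k * coeff b (i + j - k))"
      unfolding coeff_mult by (subst sum.remove[of _ i]) auto
    moreover have "dvd_in S c (\<Sum>k\<in>{..i+j} - {i}. coeff a k * coeff b (i + j - k))"
    proof (rule dvd_in_sum)
      fix k assume "k \<in> {..i+j} - {i}"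
      then consider "k < i" | "i + j - k < j" by fastforce
      then show "dvd_in S c (coeff a k * coeff b (i + j - k))"
        by cases (use i j S in \<open>auto intro: dvd_in_mult dvd_in_mult2\<close>)
    qed
    ultimately have "dvd_in S c (coeff a i * coeff b j)" using dvd_in_diff by fastforce
    then show False using assms i(1) j(1) S unfolding prime_in_def by blast
  qed
qed

lemma prime_products_const: "c \<in> prime_products S \<Longrightarrow> [:c:] \<in> prime_products (polys_over S)"
proof (induction rule: prime_products.induct)
  case (unit u)
  then obtain v where "v \<in> S" "1 = u * v" by (auto elim: dvd_inE)
  with unit show ?case
    by (intro prime_products.unit dvd_inI[of "[:v:]"]) (simp_all add: one_pCons mult.commute)
next
  case (prime p a)
  then show ?case using prime_products.prime[OF prime_in_const, of p "[:a:]"]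
    by (simp add: mult.commute)
qed

text \<open>Phrased through constant divisors, so that no gcd of the coefficients has to be
  formed.\<close>

definition primitive :: "'a poly \<Rightarrow> bool" where
  "primitive p \<longleftrightarrow> (\<forall>c\<in>S. dvd_in (polys_over S) [:c:] p \<longrightarrow> dvd_in S c 1)"

text \<open>The element \<open>a\<close> bounds the constants that can divide \<open>p\<close>. Its
  primes are treated one by one: a prime that divides \<open>p\<close> is moved into the content,
  any other is dropped from the bound. Once only a unit is left, every constant divisor of
  \<open>p\<close> is a unit.\<close>

lemma primitive_part:
  assumes "a \<in> prime_products S" "p \<in> polys_over S"
    and "\<And>c. c \<in> S \<Longrightarrow> dvd_in (polys_over S) [:c:] p \<Longrightarrow> dvd_in S c a"
  shows "\<exists>c\<in>prime_products S. \<exists>q\<in>polys_over S. p = [:c:] * q \<and> primitive q"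
  using assms
proof (induction arbitrary: p)
  case (unit u)
  then have "primitive p" unfolding primitive_def by (blast intro: dvd_in_trans)
  moreover have "1 \<in> prime_products S" by (rule prime_products.unit) auto
  ultimately show ?case using unit by (intro bexI[of _ 1] bexI[of _ p]) auto
next
  case (prime \<pi> a)
  have \<pi>: "\<pi> \<in> S" "\<pi> \<noteq> 0" using prime.hyps by (auto simp: prime_in_def)
  show ?case
  proof (cases "dvd_in (polys_over S) [:\<pi>:] p")
    case True
    then obtain q where q: "q \<in> polys_over S" "p = [:\<pi>:] * q" by (auto elim: dvd_inE)
    have "dvd_in S c a" if c: "c \<in> S" "dvd_in (polys_over S) [:c:] q" for c
    proof -
      have "dvd_in (polys_over S) [:\<pi> * c:] p" using q c by (auto simp: dvd_in_def)
      then have "dvd_in S (\<pi> * c) (\<pi> * a)" using prime.prems \<pi> c by blast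
      then show ?thesis using \<pi> by (auto simp: dvd_in_def mult.assoc)
    qed
    from prime.IH[OF q(1) this] obtain c q' where
      *: "c \<in> prime_products S" "q' \<in> polys_over S" "q = [:c:] * q'" "primitive q'" by blast
    have "\<pi> * c \<in> prime_products S" using prime * prime_products.prime by blast
    with * q show ?thesis by (intro bexI[of _ "\<pi> * c"] bexI[of _ q']) (auto simp: mult.commute)
  next
    case False
    show ?thesis
    proof (rule prime.IH[OF prime.prems(1)])
      fix c assume c: "c \<in> S" "dvd_in (polys_over S) [:c:] p"
      then obtain d where d: "d \<in> S" "\<pi> * a = c * d" using prime.prems by (metis dvd_in_def)
      then have "dvd_in S \<pi> (c * d)" using prime.hyps prime_products_closed by (metis dvd_in_def)
      then have "dvd_in S \<pi> c \<or> dvd_in S \<pi> d" using prime.hyps c d by (auto simp: prime_in_def)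
      \<comment> \<open>Otherwise \<open>\<pi>\<close> would divide \<open>p\<close> through
        \<open>c\<close>. So \<open>\<pi>\<close> divides the cofactor \<open>d\<close> and can be
        cancelled from \<open>\<pi> * a = c * d\<close>.\<close>
      moreover have "\<not> dvd_in S \<pi> c"
        using False c \<pi> by (auto simp: const_dvd_in_iff intro: dvd_in_trans)
      ultimately obtain e where "e \<in> S" "d = \<pi> * e" by (auto elim: dvd_inE)
      then have "\<pi> * a = \<pi> * (c * e)" using d by (simp add: ac_simps)
      then show "dvd_in S c a" using \<pi> \<open>e \<in> S\<close> by (auto simp: dvd_in_def)
    qed
  qed
qed

text \<open>The leading coefficient serves as the bound, since every constant that divides
  \<open>p\<close> divides it.\<close>

lemma primitive_part_ufd:
  assumes "ufd_on S" "p \<in> polys_over S" "p \<noteq> 0"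
  shows "\<exists>c\<in>prime_products S. \<exists>q\<in>polys_over S. p = [:c:] * q \<and> primitive q"
  using assms lead_coeff_closed[of p]
  by (intro primitive_part[of "lead_coeff p"]) (auto simp: ufd_on_def const_dvd_in_iff)

text \<open>This replaces the descent from the fraction field. Each prime of \<open>c\<close> stays
  prime as a constant polynomial and divides \<open>p * r\<close>, where \<open>r\<close> is the
  cofactor; it cannot divide the primitive \<open>p\<close>, so it divides \<open>r\<close> and
  cancels.\<close>

lemma primitive_dvd_cancel:
  assumes "c \<in> prime_products S" "p \<in> polys_over S" "primitive p" "q \<in> polys_over S"
    and "dvd_in (polys_over S) p ([:c:] * q)"
  shows "dvd_in (polys_over S) p q"
  using assms
proof (induction arbitrary: q)
  case (unit u)
  then obtain v where v: "v \<in> S" "u * v = 1" by (auto simp: dvd_in_def)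
  have "dvd_in (polys_over S) p ([:v:] * ([:u:] * q))"
    by (rule poly.dvd_in_mult2[OF unit.prems(4)]) (simp add: v(1))
  moreover have "[:v:] * ([:u:] * q) = q" using v by (simp add: mult.commute)
  ultimately show ?case by metis
next
  case (prime \<pi> c)
  have cS: "c \<in> S" using prime prime_products_closed by blast
  obtain r where r: "r \<in> polys_over S" "[:\<pi> * c:] * q = p * r" using prime.prems by (auto elim: dvd_inE)
  have P: "prime_in (polys_over S) [:\<pi>:]" by (rule prime_in_const[OF prime.hyps(1)])
  have \<pi>: "\<pi> \<in> S" "\<pi> \<noteq> 0" "\<not> dvd_in S \<pi> 1" using prime.hyps by (auto simp: prime_in_def)
  have eq: "[:\<pi> * c:] * q = [:\<pi>:] * ([:c:] * q)" by (simp add: mult.commute)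
  have "dvd_in (polys_over S) [:\<pi>:] (p * r)"
    unfolding r(2)[symmetric] eq using cS prime.prems by (intro dvd_inI[OF _ refl]) simp
  then have "dvd_in (polys_over S) [:\<pi>:] p \<or> dvd_in (polys_over S) [:\<pi>:] r"
    using P prime.prems r by (auto simp: prime_in_def)
  moreover have "\<not> dvd_in (polys_over S) [:\<pi>:] p" using prime.prems \<pi> by (auto simp: primitive_def)
  ultimately obtain s where s: "s \<in> polys_over S" "r = [:\<pi>:] * s" by (auto elim: dvd_inE)
  have "[:\<pi>:] * ([:c:] * q) = [:\<pi>:] * (p * s)" using r(2) s(2) unfolding eq by (simp add: ac_simps)
  then have "[:c:] * q = p * s" using \<pi> by (metis mult_cancel_left pCons_eq_0_iff)
  then show ?case using prime.IH prime.prems s by (auto simp: dvd_in_def)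
qed

text \<open>Over the fraction field, an ideal element of minimal degree is a gcd; without fractions, the
  divisibilities hold up to a power of its leading coefficient.\<close>

lemma ideal_min_degree:
  assumes "p \<in> polys_over S" "q \<in> polys_over S" "p \<noteq> 0"
  obtains t x y k l where "x \<in> polys_over S" "y \<in> polys_over S" "t = x * p + y * q" "t \<noteq> 0"
    "t \<in> polys_over S"
    "dvd_in (polys_over S) t ([:lead_coeff t ^ k:] * p)"
    "dvd_in (polys_over S) t ([:lead_coeff t ^ l:] * q)"
proof -
  define I where "I = {x * p + y * q | x y. x \<in> polys_over S \<and> y \<in> polys_over S}"
  have I_lin: "u * a + v * b \<in> I" if ab: "a \<in> I" "b \<in> I" and uv: "u \<in> polys_over S" "v \<in> polys_over S" for u v a b
  proof -
    from ab obtain x y x' y' where *: "a = x * p + y * q" "b = x' * p + y' * q" "x \<in> polys_over S"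
      "y \<in> polys_over S" "x' \<in> polys_over S" "y' \<in> polys_over S" unfolding I_def by blast
    then have "u * a + v * b = (u * x + v * x') * p + (u * y + v * y') * q" by (simp add: algebra_simps)
    with * uv show ?thesis unfolding I_def by blast
  qed
  have pI: "p \<in> I"
    unfolding I_def by (rule CollectI, rule exI[of _ 1], rule exI[of _ 0]) auto
  have qI: "q \<in> I"
    unfolding I_def by (rule CollectI, rule exI[of _ 0], rule exI[of _ 1]) auto
  have IS: "a \<in> polys_over S" if "a \<in> I" for a using that assms unfolding I_def by auto
  obtain t where t: "t \<in> I" "t \<noteq> 0" and min: "\<And>z. z \<in> I \<Longrightarrow> z \<noteq> 0 \<Longrightarrow> degree t \<le> degree z"
    using ex_has_least_nat[of "\<lambda>z. z \<in> I \<and> z \<noteq> 0" p degree] pI assms(3) by blast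
  let ?t = "lead_coeff t"
  have tS: "?t \<in> S" using t IS lead_coeff_closed by blast
  have main: "\<exists>k. dvd_in (polys_over S) t ([:?t ^ k:] * z)" if "z \<in> I" for z
    using that
  \<comment> \<open>The zero polynomial has degree 0, so the degree is shifted to rank 0 strictly
    below the nonzero constants.\<close>
  proof (induction "if z = 0 then 0 else Suc (degree z)" arbitrary: z rule: less_induct)
    case less
    show ?case
    proof (cases "z = 0")
      case True
      then show ?thesis by (auto intro!: dvd_inI[of 0])
    next
      case False
      \<comment> \<open>One step of pseudo-division: scaling \<open>z\<close> by the leading
        coefficient of \<open>t\<close> makes its leading term equal to that of
        \<open>m * t\<close>, so the difference \<open>z'\<close> drops in degree or vanishes
        without any division.\<close>
      define m where "m = monom (lead_coeff z) (degree z - degree t)"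
      define z' where "z' = [:?t:] * z + (- m) * t"
      have zS: "lead_coeff z \<in> S" using less IS lead_coeff_closed by blast
      then have mS: "m \<in> polys_over S" unfolding m_def by simp
      have z'I: "z' \<in> I" unfolding z'_def using less t tS mS by (intro I_lin) auto
      have le: "degree t \<le> degree z" using min less False by blast
      have "degree m \<le> degree z - degree t" unfolding m_def by (rule degree_monom_le)
      then have "degree (m * t) \<le> degree z" using degree_mult_le[of m t] le by linarith
      moreover have "degree ([:?t:] * z) \<le> degree z" by simp
      ultimately have dz': "degree z' \<le> degree z" unfolding z'_def by (auto intro!: degree_diff_le)
      have "coeff (m * t) (degree z) = lead_coeff z * ?t"
        unfolding m_def using coeff_monom_mult[of "lead_coeff z" "degree z - degree t" t "degree z"] le by simp
      then have "coeff z' (degree z) = 0" unfolding z'_def by simp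
      with dz' have "z' = 0 \<or> degree z' < degree z" by (metis eq_zero_or_degree_less)
      then have "(if z' = 0 then 0 else Suc (degree z')) < (if z = 0 then 0 else Suc (degree z))"
        using False by auto
      from less.hyps[OF this z'I] obtain k where "dvd_in (polys_over S) t ([:?t ^ k:] * z')" ..
      moreover have "dvd_in (polys_over S) t ([:?t ^ k:] * m * t)"
        using mS tS by (intro poly.dvd_in_mult2) auto
      ultimately have "dvd_in (polys_over S) t ([:?t ^ k:] * z' + [:?t ^ k:] * m * t)"
        by (rule poly.dvd_in_add)
      moreover have "[:?t ^ k:] * z' + [:?t ^ k:] * m * t = [:?t ^ Suc k:] * z"
        unfolding z'_def by (simp add: algebra_simps)
      ultimately show ?thesis by metis
    qed
  qed
  obtain k l where "dvd_in (polys_over S) t ([:?t ^ k:] * p)" "dvd_in (polys_over S) t ([:?t ^ l:] * q)"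
    using main pI qI by blast
  with t IS that show ?thesis unfolding I_def by blast
qed

text \<open>Let \<open>t\<close> be a combination of \<open>p\<close> and \<open>a\<close> as in
  \<open>ideal_min_degree\<close>, with primitive part \<open>s\<close>. Constants cancel, so
  \<open>s\<close> divides both \<open>p\<close> and \<open>a\<close>. Irreducibility of
  \<open>p = s * v\<close> leaves two cases: if \<open>v\<close> is a unit, \<open>p\<close> divides
  \<open>s\<close> and hence \<open>a\<close>; if \<open>s\<close> is a unit, some constant is a
  combination of \<open>p\<close> and \<open>a\<close>, which forces \<open>p\<close> to divide
  \<open>b\<close>.\<close>

lemma irreducible_imp_prime_in:
  assumes ufd: "ufd_on S" and p: "p \<in> polys_over S" "p \<noteq> 0" "primitive p"
    and nu: "\<not> dvd_in (polys_over S) p 1"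
    and irr: "\<And>q r. q \<in> polys_over S \<Longrightarrow> r \<in> polys_over S \<Longrightarrow> p = q * r \<Longrightarrow>
                dvd_in (polys_over S) q 1 \<or> dvd_in (polys_over S) r 1"
  shows "prime_in (polys_over S) p"
  unfolding prime_in_def
proof (intro conjI ballI impI p nu)
  fix a b assume ab: "a \<in> polys_over S" "b \<in> polys_over S" "dvd_in (polys_over S) p (a * b)"
  obtain t x y k l where t: "x \<in> polys_over S" "y \<in> polys_over S" "t = x * p + y * a" "t \<noteq> 0"
    "t \<in> polys_over S" "dvd_in (polys_over S) t ([:lead_coeff t ^ k:] * p)"
    "dvd_in (polys_over S) t ([:lead_coeff t ^ l:] * a)"
    by (rule ideal_min_degree[OF p(1) ab(1) p(2)])
  obtain c s where s: "c \<in> prime_products S" "s \<in> polys_over S" "t = [:c:] * s" "primitive s"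
    using primitive_part_ufd[OF ufd t(5,4)] by blast
  have cS: "c \<in> S" using s prime_products_closed by blast
  have lc: "lead_coeff t ^ n \<in> prime_products S" for n
    using ufd t(4) power_closed[OF lead_coeff_closed[OF t(5)]] by (simp add: ufd_on_def)
  have st: "dvd_in (polys_over S) s t" using s cS by (auto intro!: dvd_inI[of "[:c:]"])
  have sp: "dvd_in (polys_over S) s p"
    by (rule primitive_dvd_cancel[OF lc]) (use s p t st poly.dvd_in_trans in blast)+
  have sa: "dvd_in (polys_over S) s a"
    by (rule primitive_dvd_cancel[OF lc]) (use s ab t st poly.dvd_in_trans in blast)+
  from sp obtain v where v: "v \<in> polys_over S" "p = s * v" by (auto elim: dvd_inE)
  from irr[OF s(2) v] show "dvd_in (polys_over S) p a \<or> dvd_in (polys_over S) p b"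
  proof
    assume "dvd_in (polys_over S) v 1"
    then obtain w where w: "w \<in> polys_over S" "v * w = 1" by (auto simp: dvd_in_def)
    then have "s = p * w" using v by (simp add: mult.assoc)
    then have "dvd_in (polys_over S) p s" using w by (auto intro: dvd_inI)
    then show ?thesis using sa poly.dvd_in_trans by blast
  next
    assume "dvd_in (polys_over S) s 1"
    then obtain w where w: "w \<in> polys_over S" "s * w = 1" by (auto simp: dvd_in_def)
    \<comment> \<open>As \<open>w\<close> inverts \<open>s\<close> and \<open>t = [:c:] * s\<close>,
      the constant \<open>[:c:]\<close> equals \<open>w * t\<close>. Expanding \<open>t\<close>
      leaves a multiple of \<open>p\<close> and a multiple of \<open>a * b\<close>.\<close>
    have "[:c:] * b = w * b * t" using s w by (metis mult.assoc mult.commute mult_1)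
    also have "\<dots> = (w * b * x) * p + (w * y) * (a * b)" unfolding t(3) by (simp add: algebra_simps)
    also have "dvd_in (polys_over S) p \<dots>"
      by (rule poly.dvd_in_add[OF poly.dvd_in_mult2 poly.dvd_in_mult2[OF ab(3)]]) (use w t(1,2) ab in auto)
    finally have "dvd_in (polys_over S) p b"
      by (rule primitive_dvd_cancel[OF s(1) p(1,3) ab(2)])
    then show ?thesis ..
  qed
qed

text \<open>Induction on the degree after splitting off the content. The primitive part
  \<open>p'\<close> is a unit, or irreducible and hence prime, or a product of two non-units, both
  of smaller degree.\<close>

theorem ufd_on_polys_over:
  assumes ufd: "ufd_on S"
  shows "ufd_on (polys_over S)"
  unfolding ufd_on_def
proof (intro ballI impI)
  fix p assume "p \<in> polys_over S" "p \<noteq> 0"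
  then show "p \<in> prime_products (polys_over S)"
  proof (induction "degree p" arbitrary: p rule: less_induct)
    case less
    obtain c p' where c: "c \<in> prime_products S" "p' \<in> polys_over S" "p = [:c:] * p'" "primitive p'"
      using primitive_part_ufd[OF ufd less.prems] by blast
    have nz: "p' \<noteq> 0" "c \<noteq> 0" using c less.prems by auto
    have deg: "degree p = degree p'" using c nz by simp
    have "p' \<in> prime_products (polys_over S)"
    proof (cases "dvd_in (polys_over S) p' 1")
      case True
      then show ?thesis using c by (auto intro: prime_products.unit)
    next
      case nu: False
      show ?thesis
      proof (cases "\<forall>q\<in>polys_over S. \<forall>r\<in>polys_over S. p' = q * r \<longrightarrow>
                dvd_in (polys_over S) q 1 \<or> dvd_in (polys_over S) r 1")
        case True
        then have "prime_in (polys_over S) p'"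
          using irreducible_imp_prime_in[OF ufd c(2) nz(1) c(4) nu] by blast
        then show ?thesis
          using prime_products.prime[of _ p' 1] prime_products.unit[of 1 "polys_over S"] by auto
      next
        case False
        then obtain q r where qr: "q \<in> polys_over S" "r \<in> polys_over S" "p' = q * r"
          "\<not> dvd_in (polys_over S) q 1" "\<not> dvd_in (polys_over S) r 1" by blast
        \<comment> \<open>A constant that divides the primitive \<open>p'\<close> is a unit. Hence
          both factors have positive degree, and each degree is less than that of
          \<open>p'\<close>.\<close>
        have const: "degree u \<noteq> 0" if u: "u \<in> polys_over S" "\<not> dvd_in (polys_over S) u 1"
          "dvd_in (polys_over S) u p'" for u
        proof
          assume "degree u = 0"
          then obtain d where d: "u = [:d:]" by (metis degree_0_id degree_eq_zeroE)
          then have "dvd_in S d 1" using u c(4) by (auto simp: primitive_def)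
          then have "dvd_in (polys_over S) u 1"
            unfolding d by (auto elim!: dvd_inE simp: dvd_in_def one_pCons intro!: bexI[of _ "[:_:]"])
          with u show False by blast
        qed
        have "dvd_in (polys_over S) q p'" "dvd_in (polys_over S) r p'"
          using qr(1-3) by (auto simp: dvd_in_def mult.commute)
        then have "degree q \<noteq> 0" "degree r \<noteq> 0" using const qr by blast+
        moreover have "degree p' = degree q + degree r" "q \<noteq> 0" "r \<noteq> 0"
          using qr nz by (auto simp: degree_mult_eq)
        ultimately have "q \<in> prime_products (polys_over S)" "r \<in> prime_products (polys_over S)"
          using less.hyps[of q] less.hyps[of r] qr deg by auto
        then show ?thesis using qr poly.prime_products_mult by blast
      qed
    qed
    then show ?case using c poly.prime_products_mult prime_products_const by blast
  qed
qed

text \<open>Divisibility, units and primes are expressed by products, 0 and 1, so an injective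
  multiplicative map transports factorizations. It is later applied to the substitution of a
  variable into a univariate polynomial.\<close>

lemma ufd_on_image:
  fixes h :: "'a \<Rightarrow> 'b::idom"
  assumes ufd: "ufd_on S" and inj: "inj_on h S"
    and h: "h 1 = 1" "h 0 = 0" "\<And>a b. a \<in> S \<Longrightarrow> b \<in> S \<Longrightarrow> h (a * b) = h a * h b"
  shows "ufd_on (h ` S)"
proof -
  have dvd: "dvd_in (h ` S) (h a) (h b) \<longleftrightarrow> dvd_in S a b" if "a \<in> S" "b \<in> S" for a b
  proof -
    have "h b = h a * h c \<longleftrightarrow> b = a * c" if "c \<in> S" for c
      using that \<open>a \<in> S\<close> \<open>b \<in> S\<close> h inj by (metis inj_on_contraD mult_closed)
    then show ?thesis by (auto simp: dvd_in_def)
  qed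
  have prime: "prime_in (h ` S) (h p)" if "prime_in S p" for p
    using that dvd[of p 1] inj_on_eq_iff[OF inj, of p 0]
    by (auto simp: prime_in_def dvd h(3)[symmetric] h(1,2))
  have "h a \<in> prime_products (h ` S)" if "a \<in> prime_products S" for a
    using that
  proof induction
    case (unit u)
    then show ?case using dvd[of u 1] h by (auto intro: prime_products.unit)
  next
    case (prime p a)
    then have "h (p * a) = h p * h a" using prime_products_closed h by (auto simp: prime_in_def)
    then show ?case using prime \<open>\<And>p. prime_in S p \<Longrightarrow> _\<close> by (auto intro: prime_products.prime)
  qed
  then show ?thesis using ufd h(2) by (auto simp: ufd_on_def)
qed

end

section \<open>Partial derivatives of smooth functions\<close>

text \<open>Rebasing \<open>x\<close> at \<open>x(i := t)\<close> gives the derivative at every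
  point of the coordinate line, as the mean value theorem requires.\<close>

lemma has_partial_deriv:
  assumes "partial_differentiable i f"
  shows "((\<lambda>s. f (x(i := s))) has_real_derivative partial_deriv i f (x(i := t))) (at t)"
  using assms[unfolded partial_differentiable_def, rule_format, of "x(i := t)"]
  by (simp add: partial_deriv_def DERIV_deriv_iff_real_differentiable)

lemma partial_deriv_eqI:
  assumes "\<And>x. ((\<lambda>s. f (x(i := s))) has_real_derivative g x) (at (x i))"
  shows "partial_deriv i f = g" "partial_differentiable i f"
  using assms by (auto simp: partial_deriv_def partial_differentiable_def fun_eq_iff
      real_differentiable_def intro!: DERIV_imp_deriv)

text \<open>The mean value theorem is applied first in direction \<open>i\<close> to the increment
  of \<open>f\<close> in direction \<open>j\<close>, then in direction \<open>j\<close> to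
  \<open>partial_deriv i f\<close>. The left-hand side is symmetric in \<open>i\<close> and
  \<open>j\<close>.\<close>

lemma second_difference:
  assumes "partial_differentiable i f" "partial_differentiable j (partial_deriv i f)"
    and "i \<noteq> j" "0 < h"
  shows "\<exists>s t. x i < s \<and> s < x i + h \<and> x j < t \<and> t < x j + h \<and>
    f (x(i := x i + h, j := x j + h)) - f (x(i := x i + h)) - f (x(j := x j + h)) + f x =
    h * h * partial_deriv j (partial_deriv i f) (x(i := s, j := t))"
proof -
  let ?y = "x(j := x j + h)"
  have "\<exists>s. x i < s \<and> s < x i + h \<and>
      (f (?y(i := x i + h)) - f (x(i := x i + h))) - (f (?y(i := x i)) - f (x(i := x i))) =
      (x i + h - x i) * (partial_deriv i f (?y(i := s)) - partial_deriv i f (x(i := s)))"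
    using assms by (intro MVT2 derivative_intros has_partial_deriv) auto
  then obtain s where s: "x i < s" "s < x i + h"
    "(f (?y(i := x i + h)) - f (x(i := x i + h))) - (f (?y(i := x i)) - f (x(i := x i))) =
      h * (partial_deriv i f (?y(i := s)) - partial_deriv i f (x(i := s)))" by auto
  let ?z = "x(i := s)"
  have "\<exists>t. x j < t \<and> t < x j + h \<and>
      partial_deriv i f (?z(j := x j + h)) - partial_deriv i f (?z(j := x j)) =
      (x j + h - x j) * partial_deriv j (partial_deriv i f) (?z(j := t))"
    using assms by (intro MVT2 has_partial_deriv) auto
  then obtain t where t: "x j < t" "t < x j + h"
    "partial_deriv i f (?z(j := x j + h)) - partial_deriv i f (?z(j := x j)) =
      h * partial_deriv j (partial_deriv i f) (?z(j := t))" by auto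
  have "?z(j := x j) = ?z" "?y(i := s) = ?z(j := x j + h)" "?y(i := x i) = ?y"
    "?y(i := x i + h) = x(i := x i + h, j := x j + h)"
    using assms(3) by (auto simp: fun_eq_iff)
  with s t show ?thesis by (intro exI[of _ s] exI[of _ t]) (simp add: mult.assoc)
qed

text \<open>Schwarz's theorem. For steps \<open>h n\<close> tending to 0, the symmetric second
  difference equals \<open>h n * h n\<close> times either mixed derivative, each at a point near
  \<open>x\<close>. These points converge to \<open>x\<close>, and continuity identifies the
  limits.\<close>

theorem partial_deriv_commute:
  assumes "partial_differentiable i f" "partial_differentiable j f"
    and "partial_differentiable j (partial_deriv i f)" "partial_differentiable i (partial_deriv j f)"
    and "continuous_on UNIV (partial_deriv j (partial_deriv i f))"
    and "continuous_on UNIV (partial_deriv i (partial_deriv j f))"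
  shows "partial_deriv i (partial_deriv j f) = partial_deriv j (partial_deriv i f)"
proof (cases "i = j")
  case False
  show ?thesis
  proof
    fix x
    define h where "h n = 1 / real (Suc n)" for n
    have h: "h n > 0" for n by (simp add: h_def)
    have h0: "h \<longlonglongrightarrow> 0" unfolding h_def by (rule LIMSEQ_Suc[OF lim_1_over_n])
    have lim: "(\<lambda>n. x(i := s n, j := t n)) \<longlonglongrightarrow> x"
      if "\<And>n. x i < s n \<and> s n < x i + h n \<and> x j < t n \<and> t n < x j + h n" for s t
    proof -
      have "s \<longlonglongrightarrow> x i"
        by (rule tendsto_sandwich[of "\<lambda>_. x i" _ _ "\<lambda>n. x i + h n"])
          (use that less_imp_le tendsto_add[OF tendsto_const h0, of "x i"] in \<open>auto intro!: always_eventually\<close>)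
      moreover have "t \<longlonglongrightarrow> x j"
        by (rule tendsto_sandwich[of "\<lambda>_. x j" _ _ "\<lambda>n. x j + h n"])
          (use that less_imp_le tendsto_add[OF tendsto_const h0, of "x j"] in \<open>auto intro!: always_eventually\<close>)
      ultimately have l: "(\<lambda>n. (s n, t n)) \<longlonglongrightarrow> (x i, x j)" by (rule tendsto_Pair)
      \<comment> \<open>In the product topology continuity is checked coordinatewise, and only the
        coordinates \<open>i\<close> and \<open>j\<close> vary with the parameters.\<close>
      have "continuous_on UNIV (\<lambda>p::real \<times> real. x(i := fst p, j := snd p))"
      proof (rule continuous_on_coordinatewise_then_product)
        show "continuous_on UNIV (\<lambda>p::real \<times> real. (x(i := fst p, j := snd p)) k)" for k
          by (cases "k = j"; cases "k = i") (auto intro!: continuous_intros)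
      qed
      from continuous_on_tendsto_compose[OF this l] show ?thesis by simp
    qed
    let ?D = "\<lambda>h. f (x(i := x i + h, j := x j + h)) - f (x(i := x i + h)) - f (x(j := x j + h)) + f x"
    have "\<forall>n. \<exists>s t. x i < s \<and> s < x i + h n \<and> x j < t \<and> t < x j + h n \<and>
        ?D (h n) = h n * h n * partial_deriv j (partial_deriv i f) (x(i := s, j := t))"
      using second_difference[OF assms(1,3) False h] by blast
    then obtain s t where 1: "\<And>n. x i < s n \<and> s n < x i + h n \<and> x j < t n \<and> t n < x j + h n"
      "\<And>n. ?D (h n) = h n * h n * partial_deriv j (partial_deriv i f) (x(i := s n, j := t n))"
      by metis
    have "\<forall>n. \<exists>s t. x i < s \<and> s < x i + h n \<and> x j < t \<and> t < x j + h n \<and>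
        ?D (h n) = h n * h n * partial_deriv i (partial_deriv j f) (x(i := s, j := t))"
    proof
      fix n
      from second_difference[OF assms(2,4) False[symmetric] h, of x n] obtain s t where
        "x j < s" "s < x j + h n" "x i < t" "t < x i + h n"
        "f (x(j := x j + h n, i := x i + h n)) - f (x(j := x j + h n)) - f (x(i := x i + h n)) + f x =
          h n * h n * partial_deriv i (partial_deriv j f) (x(j := s, i := t))" by blast
      with False show "\<exists>s t. x i < s \<and> s < x i + h n \<and> x j < t \<and> t < x j + h n \<and>
        ?D (h n) = h n * h n * partial_deriv i (partial_deriv j f) (x(i := s, j := t))"
        by (intro exI[of _ t] exI[of _ s]) (simp add: fun_upd_twist[OF False])
    qed
    then obtain s' t' where 2: "\<And>n. x i < s' n \<and> s' n < x i + h n \<and> x j < t' n \<and> t' n < x j + h n"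
      "\<And>n. ?D (h n) = h n * h n * partial_deriv i (partial_deriv j f) (x(i := s' n, j := t' n))"
      by metis
    have "partial_deriv j (partial_deriv i f) (x(i := s n, j := t n)) =
        partial_deriv i (partial_deriv j f) (x(i := s' n, j := t' n))" for n
      using 1(2)[of n] 2(2)[of n] h[of n] by simp
    moreover have "(\<lambda>n. partial_deriv j (partial_deriv i f) (x(i := s n, j := t n)))
        \<longlonglongrightarrow> partial_deriv j (partial_deriv i f) x"
      using continuous_on_tendsto_compose[OF assms(5) lim[OF 1(1)]] by simp
    moreover have "(\<lambda>n. partial_deriv i (partial_deriv j f) (x(i := s' n, j := t' n)))
        \<longlonglongrightarrow> partial_deriv i (partial_deriv j f) x"
      using continuous_on_tendsto_compose[OF assms(6) lim[OF 2(1)]] by simp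
    ultimately show "partial_deriv i (partial_deriv j f) x = partial_deriv j (partial_deriv i f) x"
      using LIMSEQ_unique by simp
  qed
qed simp

section \<open>Closure properties of smooth functions\<close>

lemma partial_deriv_outside:
  assumes "depends_on_first m f" "m \<le> i"
  shows "partial_deriv i f = (\<lambda>x. 0)" "partial_differentiable i f"
proof -
  have "(\<lambda>t. f (x(i := t))) = (\<lambda>t. f x)" for x
  proof
    show "f (x(i := t)) = f x" for t
      using assms by (intro assms(1)[unfolded depends_on_first_def, rule_format]) auto
  qed
  then show "partial_deriv i f = (\<lambda>x. 0)" "partial_differentiable i f"
    by (auto simp: partial_deriv_def partial_differentiable_def)
qed

lemma depends_on_first_partial_deriv:
  assumes "depends_on_first m f"
  shows "depends_on_first m (partial_deriv i f)"
proof (cases "i < m")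
  case True
  have "(\<lambda>t. f (x(i := t))) = (\<lambda>t. f (y(i := t)))" if "\<forall>i<m. x i = y i" for x y
  proof
    show "f (x(i := t)) = f (y(i := t))" for t
      using that by (intro assms[unfolded depends_on_first_def, rule_format]) auto
  qed
  then show ?thesis using True unfolding depends_on_first_def partial_deriv_def by metis
next
  case False
  then show ?thesis using partial_deriv_outside[OF assms] by (simp add: depends_on_first_def)
qed

lemma foldr_partial_deriv_zero: "foldr partial_deriv is (\<lambda>x. 0) = (\<lambda>x. 0)"
  by (induction "is") (auto simp: partial_deriv_def)

lemma C_infinity_zero: "(\<lambda>x. 0) \<in> C_infinity m"
  by (auto simp: C_infinity_def depends_on_first_def foldr_partial_deriv_zero
      partial_differentiable_def)

lemma C_infinity_partial_deriv:
  assumes "f \<in> C_infinity m"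
  shows "partial_deriv i f \<in> C_infinity m"
proof (cases "i < m")
  case True
  have "continuous_on UNIV (foldr partial_deriv is (partial_deriv i f)) \<and>
        (\<forall>j<m. partial_differentiable j (foldr partial_deriv is (partial_deriv i f)))"
    if "set is \<subseteq> {..<m}" for "is"
  proof -
    have "set (is @ [i]) \<subseteq> {..<m}" using that True by simp
    with assms have "continuous_on UNIV (foldr partial_deriv (is @ [i]) f) \<and>
        (\<forall>j<m. partial_differentiable j (foldr partial_deriv (is @ [i]) f))"
      unfolding C_infinity_def by blast
    then show ?thesis by simp
  qed
  then show ?thesis using assms by (auto simp: C_infinity_def depends_on_first_partial_deriv)
next
  case False
  with assms have "partial_deriv i f = (\<lambda>x. 0)"
    by (intro partial_deriv_outside(1)[of m]) (auto simp: C_infinity_def)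
  then show ?thesis by (simp add: C_infinity_zero)
qed

text \<open>Valid in every direction \<open>i\<close>: the definition covers \<open>i < m\<close>,
  and along the other coordinates the function is constant.\<close>

lemma C_infinityD:
  assumes "f \<in> C_infinity m"
  shows "partial_differentiable i f" "continuous_on UNIV f"
  using assms partial_deriv_outside(2)[of m f i] unfolding C_infinity_def
  by (cases "i < m"; auto dest: spec[of _ "[]"])+

lemma C_infinity_foldr: "f \<in> C_infinity m \<Longrightarrow> foldr partial_deriv is f \<in> C_infinity m"
  by (induction "is") (auto intro: C_infinity_partial_deriv)

text \<open>Iterated derivatives in arbitrary directions stay in \<open>C_infinity m\<close>, so the
  directions added between \<open>m\<close> and \<open>m'\<close> cause no new condition to
  fail.\<close>

lemma C_infinity_mono:
  assumes "f \<in> C_infinity m" "m \<le> m'"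
  shows "f \<in> C_infinity m'"
proof -
  have "depends_on_first m' f" using assms by (auto simp: C_infinity_def depends_on_first_def)
  then show ?thesis using C_infinityD[OF C_infinity_foldr[OF assms(1)]]
    by (auto simp: C_infinity_def)
qed

lemma partial_deriv_linear:
  assumes "partial_differentiable i f" "partial_differentiable i g"
  shows "partial_deriv i (\<lambda>x. a * f x + b * g x) = (\<lambda>x. a * partial_deriv i f x + b * partial_deriv i g x)"
    and "partial_differentiable i (\<lambda>x. a * f x + b * g x)"
proof -
  have "((\<lambda>s. a * f (x(i := s)) + b * g (x(i := s))) has_real_derivative
      a * partial_deriv i f x + b * partial_deriv i g x) (at (x i))" for x
    using has_partial_deriv[OF assms(1), of x "x i"] has_partial_deriv[OF assms(2), of x "x i"]
    by (auto intro!: derivative_eq_intros)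
  from partial_deriv_eqI[OF this]
  show "partial_deriv i (\<lambda>x. a * f x + b * g x) = (\<lambda>x. a * partial_deriv i f x + b * partial_deriv i g x)"
    "partial_differentiable i (\<lambda>x. a * f x + b * g x)" by auto
qed

lemma C_infinity_linear:
  assumes "f \<in> C_infinity m" "g \<in> C_infinity m"
  shows "(\<lambda>x. a * f x + b * g x) \<in> C_infinity m"
proof -
  have eq: "foldr partial_deriv is (\<lambda>x. a * f x + b * g x) =
      (\<lambda>x. a * foldr partial_deriv is f x + b * foldr partial_deriv is g x)" for "is"
    by (induction "is") (auto simp: partial_deriv_linear C_infinityD[OF C_infinity_foldr[OF assms(1)]]
        C_infinityD[OF C_infinity_foldr[OF assms(2)]])
  have "depends_on_first m (\<lambda>x. a * f x + b * g x)"
    unfolding depends_on_first_def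
  proof (intro allI impI)
    fix x y :: "nat \<Rightarrow> real" assume "\<forall>i<m. x i = y i"
    with assms have "f x = f y" "g x = g y" unfolding C_infinity_def depends_on_first_def by blast+
    then show "a * f x + b * g x = a * f y + b * g y" by simp
  qed
  moreover have "continuous_on UNIV (foldr partial_deriv is (\<lambda>x. a * f x + b * g x))" for "is"
    unfolding eq using assms by (intro continuous_intros C_infinityD(2) C_infinity_foldr)
  moreover have "partial_differentiable i (foldr partial_deriv is (\<lambda>x. a * f x + b * g x))" for i "is"
    unfolding eq using assms by (intro partial_deriv_linear(2) C_infinityD(1) C_infinity_foldr)
  ultimately show ?thesis by (simp add: C_infinity_def)
qed

lemma smooth_obtain2:
  assumes "f \<in> smooth_functions" "g \<in> smooth_functions"
  obtains m where "f \<in> C_infinity m" "g \<in> C_infinity m"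
proof -
  from assms obtain m m' where "f \<in> C_infinity m" "g \<in> C_infinity m'" by (auto simp: smooth_functions_def)
  then show ?thesis using that[of "max m m'"] C_infinity_mono by (metis max.cobounded1 max.cobounded2)
qed

lemma smooth_linear:
  assumes "f \<in> smooth_functions" "g \<in> smooth_functions"
  shows "(\<lambda>x. a * f x + b * g x) \<in> smooth_functions"
proof -
  obtain m where "f \<in> C_infinity m" "g \<in> C_infinity m" by (rule smooth_obtain2[OF assms])
  then have "(\<lambda>x. a * f x + b * g x) \<in> C_infinity m" by (rule C_infinity_linear)
  then show ?thesis by (auto simp: smooth_functions_def)
qed

lemma smooth_zero: "(\<lambda>x. 0) \<in> smooth_functions"
  using C_infinity_zero by (auto simp: smooth_functions_def)

lemma smooth_partial_deriv: "f \<in> smooth_functions \<Longrightarrow> partial_deriv i f \<in> smooth_functions"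
  using C_infinity_partial_deriv by (auto simp: smooth_functions_def)

lemma smooth_partial_differentiable: "f \<in> smooth_functions \<Longrightarrow> partial_differentiable i f"
  using C_infinityD by (auto simp: smooth_functions_def)

lemma smooth_partial_deriv_commute:
  assumes "f \<in> smooth_functions"
  shows "partial_deriv i (partial_deriv j f) = partial_deriv j (partial_deriv i f)"
proof -
  obtain m where "f \<in> C_infinity m" using assms by (auto simp: smooth_functions_def)
  then show ?thesis by (intro partial_deriv_commute C_infinityD C_infinity_partial_deriv)
qed

section \<open>Linear operators commuting with partial derivatives\<close>

text \<open>These conditions hold for a single partial derivative and survive composition, so they
  pass to powers and to \<open>mixed_deriv\<close>. Sums and scalar multiples are special cases of
  the one linearity clause.\<close>

definition smooth_op :: "(real_fun \<Rightarrow> real_fun) \<Rightarrow> bool" where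
  "smooth_op D \<longleftrightarrow> (\<forall>f\<in>smooth_functions. D f \<in> smooth_functions \<and>
     (\<forall>i. D (partial_deriv i f) = partial_deriv i (D f)) \<and>
     (\<forall>g\<in>smooth_functions. \<forall>a b. D (\<lambda>x. a * f x + b * g x) = (\<lambda>x. a * D f x + b * D g x)))"

lemma smooth_opI:
  assumes "\<And>f. f \<in> smooth_functions \<Longrightarrow> D f \<in> smooth_functions"
    and "\<And>f i. f \<in> smooth_functions \<Longrightarrow> D (partial_deriv i f) = partial_deriv i (D f)"
    and "\<And>f g a b. f \<in> smooth_functions \<Longrightarrow> g \<in> smooth_functions \<Longrightarrow>
      D (\<lambda>x. a * f x + b * g x) = (\<lambda>x. a * D f x + b * D g x)"
  shows "smooth_op D"
  using assms unfolding smooth_op_def by blast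

lemma smooth_opD:
  assumes "smooth_op D" "f \<in> smooth_functions"
  shows "D f \<in> smooth_functions" "D (partial_deriv i f) = partial_deriv i (D f)"
    and "g \<in> smooth_functions \<Longrightarrow> D (\<lambda>x. a * f x + b * g x) = (\<lambda>x. a * D f x + b * D g x)"
  using assms unfolding smooth_op_def by blast+

lemma smooth_op_partial_deriv: "smooth_op (partial_deriv i)"
  by (intro smooth_opI smooth_partial_deriv smooth_partial_deriv_commute partial_deriv_linear
      smooth_partial_differentiable)

lemma smooth_op_comp:
  assumes "smooth_op D" "smooth_op E"
  shows "smooth_op (D \<circ> E)"
  by (rule smooth_opI) (simp_all add: smooth_opD[OF assms(1)] smooth_opD[OF assms(2)])

lemma smooth_op_id: "smooth_op id"
  by (rule smooth_opI) simp_all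

lemma smooth_op_funpow: "smooth_op D \<Longrightarrow> smooth_op (D ^^ n)"
  by (induction n) (simp_all add: smooth_op_id smooth_op_comp)

lemma smooth_op_mixed_deriv: "smooth_op (mixed_deriv n \<alpha>)"
proof (induction n)
  case 0
  have "mixed_deriv 0 \<alpha> = id" by (simp add: fun_eq_iff)
  then show ?case by (simp only: smooth_op_id)
next
  case (Suc n)
  have "mixed_deriv (Suc n) \<alpha> = mixed_deriv n \<alpha> \<circ> (partial_deriv n ^^ \<alpha> n)" by (simp add: fun_eq_iff)
  then show ?case by (simp only: smooth_op_comp Suc smooth_op_funpow smooth_op_partial_deriv)
qed

lemma smooth_op_commute_funpow:
  assumes "smooth_op D" "f \<in> smooth_functions"
  shows "D ((partial_deriv i ^^ k) f) = (partial_deriv i ^^ k) (D f)"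
proof (induction k)
  case (Suc k)
  have "(partial_deriv i ^^ k) f \<in> smooth_functions"
    by (rule smooth_opD(1)[OF smooth_op_funpow[OF smooth_op_partial_deriv] assms(2)])
  then show ?case using smooth_opD(2)[OF assms(1)] Suc by simp
qed simp

lemma mixed_deriv_add:
  assumes "f \<in> smooth_functions"
  shows "mixed_deriv n (\<lambda>i. \<alpha> i + \<beta> i) f = mixed_deriv n \<alpha> (mixed_deriv n \<beta> f)"
  using assms
proof (induction n arbitrary: f)
  case (Suc n)
  let ?P = "\<lambda>k. partial_deriv n ^^ k"
  have sm: "?P k g \<in> smooth_functions" if "g \<in> smooth_functions" for k g
    by (rule smooth_opD(1)[OF smooth_op_funpow[OF smooth_op_partial_deriv] that])
  have "mixed_deriv (Suc n) (\<lambda>i. \<alpha> i + \<beta> i) f = mixed_deriv n \<alpha> (mixed_deriv n \<beta> (?P (\<alpha> n) (?P (\<beta> n) f)))"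
    using Suc sm by (simp add: funpow_add)
  \<comment> \<open>The derivatives in variable \<open>n\<close> belonging to
    \<open>\<alpha>\<close> are pulled out past those of \<open>\<beta>\<close> in the lower
    variables; this is where commutation enters.\<close>
  also have "mixed_deriv n \<beta> (?P (\<alpha> n) (?P (\<beta> n) f)) = ?P (\<alpha> n) (mixed_deriv n \<beta> (?P (\<beta> n) f))"
    using Suc sm by (intro smooth_op_commute_funpow smooth_op_mixed_deriv) auto
  finally show ?case by simp
qed simp

lemma mixed_deriv_extend:
  assumes "\<And>i. n \<le> i \<Longrightarrow> \<alpha> i = 0" "n \<le> m"
  shows "mixed_deriv m \<alpha> = mixed_deriv n \<alpha>"
  using assms(2)
proof (induction m rule: dec_induct)
  case (step k)
  then show ?case using assms(1)[of k] by (simp add: fun_eq_iff)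
qed simp

section \<open>Exponentials as joint eigenfunctions of the partial derivatives\<close>

definition exp_fun :: "(nat \<Rightarrow> real) \<Rightarrow> nat \<Rightarrow> real_fun" where
  "exp_fun t m x = exp (\<Sum>i<m. t i * x i)"

text \<open>The scalar \<open>c\<close> is carried along so that the derivative has the same shape
  and the rule can be iterated. In directions beyond \<open>m\<close> the eigenvalue is 0.\<close>

lemma exp_fun_partial:
  shows "partial_deriv j (\<lambda>x. c * exp_fun t m x) = (\<lambda>x. (if j < m then t j else 0) * c * exp_fun t m x)"
    and "partial_differentiable j (\<lambda>x. c * exp_fun t m x)"
proof -
  have "((\<lambda>s. c * exp_fun t m (x(j := s))) has_real_derivative
      (if j < m then t j else 0) * c * exp_fun t m x) (at (x j))" for x
  proof -
    have "((\<lambda>s. t i * (x(j := s)) i) has_real_derivative (if i = j then t j else 0)) (at (x j))" for i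
      by (auto intro!: derivative_eq_intros)
    then have "((\<lambda>s. \<Sum>i<m. t i * (x(j := s)) i) has_real_derivative (\<Sum>i<m. if i = j then t j else 0)) (at (x j))"
      by (intro derivative_intros)
    from DERIV_cmult[OF DERIV_fun_exp[OF this], of c] show ?thesis
      unfolding exp_fun_def fun_upd_triv by (simp add: mult_ac)
  qed
  from partial_deriv_eqI[OF this]
  show "partial_deriv j (\<lambda>x. c * exp_fun t m x) = (\<lambda>x. (if j < m then t j else 0) * c * exp_fun t m x)"
    "partial_differentiable j (\<lambda>x. c * exp_fun t m x)" by auto
qed

lemma exp_fun_smooth: "(\<lambda>x. c * exp_fun t m x) \<in> smooth_functions"
proof -
  have ex: "\<exists>d. foldr partial_deriv is (\<lambda>x. c * exp_fun t m x) = (\<lambda>x. d * exp_fun t m x)" for "is"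
    by (induction "is") (auto simp: exp_fun_partial)
  have cont: "continuous_on UNIV (exp_fun t m)"
    unfolding exp_fun_def by (intro continuous_intros continuous_on_product_coordinates)
  have dep: "depends_on_first m (\<lambda>x. c * exp_fun t m x)"
    by (auto simp: depends_on_first_def exp_fun_def)
  have "continuous_on UNIV (foldr partial_deriv is (\<lambda>x. c * exp_fun t m x)) \<and>
        (\<forall>i<m. partial_differentiable i (foldr partial_deriv is (\<lambda>x. c * exp_fun t m x)))" for "is"
    using ex[of "is"] cont by (auto intro!: continuous_intros exp_fun_partial)
  with dep have "(\<lambda>x. c * exp_fun t m x) \<in> C_infinity m" by (simp add: C_infinity_def)
  then show ?thesis by (auto simp: smooth_functions_def)
qed

lemma mixed_deriv_exp_fun:
  assumes "n \<le> m"
  shows "mixed_deriv n \<alpha> (\<lambda>x. c * exp_fun t m x) = (\<lambda>x. (\<Prod>i<n. t i ^ \<alpha> i) * c * exp_fun t m x)"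
  using assms
proof (induction n arbitrary: c)
  case (Suc n)
  have "(partial_deriv n ^^ k) (\<lambda>x. c * exp_fun t m x) = (\<lambda>x. (t n ^ k * c) * exp_fun t m x)" for k
    using Suc.prems
  proof (induction k)
    case (Suc k)
    then show ?case using exp_fun_partial(1)[of n "t n ^ k * c" t m] by (simp add: mult.assoc)
  qed simp
  with Suc.IH[of "t n ^ \<alpha> n * c"] Suc.prems show ?case by (simp add: mult.assoc)
qed simp

section \<open>Multivariate polynomials and their differential operators\<close>

type_synonym real_mpoly = "(nat \<Rightarrow>\<^sub>0 nat) \<Rightarrow>\<^sub>0 real"

abbreviation lookup :: "('a \<Rightarrow>\<^sub>0 'b::zero) \<Rightarrow> 'a \<Rightarrow> 'b" where
  "lookup \<equiv> Poly_Mapping.lookup"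

abbreviation keys :: "('a \<Rightarrow>\<^sub>0 'b::zero) \<Rightarrow> 'a set" where
  "keys \<equiv> Poly_Mapping.keys"

abbreviation single :: "'a \<Rightarrow> 'b::zero \<Rightarrow> 'a \<Rightarrow>\<^sub>0 'b" where
  "single \<equiv> Poly_Mapping.single"

text \<open>\<open>Poly_Mapping.degree k\<close> is the strict upper bound \<open>Suc (Max (keys k))\<close> of the variables in the
  multi-index \<open>k\<close>, not its total degree.\<close>

abbreviation bound :: "(nat \<Rightarrow>\<^sub>0 'b::zero) \<Rightarrow> nat" where
  "bound \<equiv> Poly_Mapping.degree"

text \<open>The added key need not be new and its coefficient may be 0. The rule serves both for
  polynomials and for their multi-indices.\<close>

lemma poly_mapping_add_induct [case_names zero add]:
  fixes p :: "'a \<Rightarrow>\<^sub>0 'b::comm_monoid_add"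
  assumes "P 0" and "\<And>k c p. P p \<Longrightarrow> P (single k c + p)"
  shows "P p"
proof -
  have "P (\<Sum>k\<in>A. single k (lookup p k))" if "finite A" for A
    using that by (induction A) (auto intro: assms)
  moreover have "p = (\<Sum>k\<in>keys p. single k (lookup p k))"
    by (rule poly_mapping_eqI) (auto simp: lookup_sum lookup_single when_def in_keys_iff)
  ultimately show ?thesis by (metis finite_keys)
qed

definition monom_deriv :: "(nat \<Rightarrow>\<^sub>0 nat) \<Rightarrow> real_fun \<Rightarrow> real_fun" where
  "monom_deriv k = mixed_deriv (bound k) (lookup k)"

lemma monom_deriv_eq:
  assumes "\<And>i. n \<le> i \<Longrightarrow> lookup k i = 0"
  shows "monom_deriv k = mixed_deriv n (lookup k)"
proof -
  have "mixed_deriv (max n (bound k)) (lookup k) = mixed_deriv n (lookup k)"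
    using assms by (intro mixed_deriv_extend) auto
  moreover have "mixed_deriv (max n (bound k)) (lookup k) = mixed_deriv (bound k) (lookup k)"
    by (intro mixed_deriv_extend) (auto simp: beyond_degree_lookup_zero)
  ultimately show ?thesis by (simp add: monom_deriv_def)
qed

lemma smooth_op_monom_deriv: "smooth_op (monom_deriv k)"
  by (simp add: monom_deriv_def smooth_op_mixed_deriv)

lemma monom_deriv_add:
  assumes "f \<in> smooth_functions"
  shows "monom_deriv (k + l) f = monom_deriv k (monom_deriv l f)"
proof -
  let ?n = "max (bound k) (bound l)"
  have "monom_deriv k = mixed_deriv ?n (lookup k)" "monom_deriv l = mixed_deriv ?n (lookup l)"
    "monom_deriv (k + l) = mixed_deriv ?n (lookup (k + l))"
    by (auto intro!: monom_deriv_eq simp: beyond_degree_lookup_zero lookup_add)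
  moreover have "lookup (k + l) = (\<lambda>i. lookup k i + lookup l i)" by (simp add: fun_eq_iff lookup_add)
  ultimately show ?thesis using mixed_deriv_add[OF assms] by metis
qed

section \<open>Operators and values of polynomials\<close>

definition mpoly_op :: "real_mpoly \<Rightarrow> real_fun \<Rightarrow> real_fun" where
  "mpoly_op p f x = (\<Sum>k\<in>keys p. lookup p k * monom_deriv k f x)"

definition mpoly_eval :: "(nat \<Rightarrow> real) \<Rightarrow> real_mpoly \<Rightarrow> real" where
  "mpoly_eval t p = (\<Sum>k\<in>keys p. lookup p k * (\<Prod>i<bound k. t i ^ lookup k i))"

lemma keys_sum_extend:
  fixes F :: "'a \<Rightarrow> real"
  assumes "finite A" "keys p \<subseteq> A"
  shows "(\<Sum>k\<in>keys p. lookup p k * F k) = (\<Sum>k\<in>A. lookup p k * F k)"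
  using assms by (intro sum.mono_neutral_left) (auto simp: in_keys_iff)

text \<open>Terms may cancel in \<open>p + q\<close>, so all three sums are first taken over
  \<open>keys p \<union> keys q\<close>, where they can be compared coefficientwise.\<close>

lemma keys_sum_add:
  fixes F :: "'a \<Rightarrow> real"
  shows "(\<Sum>k\<in>keys (p + q). lookup (p + q) k * F k) =
    (\<Sum>k\<in>keys p. lookup p k * F k) + (\<Sum>k\<in>keys q. lookup q k * F k)"
  using keys_sum_extend[of "keys p \<union> keys q" "p + q" F] keys_sum_extend[of "keys p \<union> keys q" p F]
    keys_sum_extend[of "keys p \<union> keys q" q F] Poly_Mapping.keys_add[of p q]
  by (simp add: lookup_add distrib_right sum.distrib)

lemma mpoly_op_zero: "mpoly_op 0 f = (\<lambda>x. 0)"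
  by (simp add: mpoly_op_def fun_eq_iff)

lemma mpoly_op_add: "mpoly_op (p + q) f = (\<lambda>x. mpoly_op p f x + mpoly_op q f x)"
  unfolding mpoly_op_def fun_eq_iff by (simp add: keys_sum_add)

lemma mpoly_op_single: "mpoly_op (single k c) f = (\<lambda>x. c * monom_deriv k f x)"
  by (simp add: mpoly_op_def fun_eq_iff)

lemma smooth_add: "f \<in> smooth_functions \<Longrightarrow> g \<in> smooth_functions \<Longrightarrow> (\<lambda>x. f x + g x) \<in> smooth_functions"
  using smooth_linear[of f g 1 1] by simp

lemma smooth_mult: "f \<in> smooth_functions \<Longrightarrow> (\<lambda>x. c * f x) \<in> smooth_functions"
  using smooth_linear[of f f c 0] by simp

lemma mpoly_op_smooth:
  assumes "f \<in> smooth_functions"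
  shows "mpoly_op p f \<in> smooth_functions"
proof (induction p rule: poly_mapping_add_induct)
  case zero
  show ?case by (simp add: mpoly_op_zero smooth_zero)
next
  case (add k c p)
  then show ?case unfolding mpoly_op_add mpoly_op_single
    using assms by (intro smooth_add smooth_mult smooth_opD(1)[OF smooth_op_monom_deriv])
qed

lemma monom_deriv_linear:
  assumes "f \<in> smooth_functions" "g \<in> smooth_functions"
  shows "monom_deriv k (\<lambda>x. f x + g x) = (\<lambda>x. monom_deriv k f x + monom_deriv k g x)"
    and "monom_deriv k (\<lambda>x. c * f x) = (\<lambda>x. c * monom_deriv k f x)"
  using smooth_opD(3)[OF smooth_op_monom_deriv assms, of k 1 1]
    smooth_opD(3)[OF smooth_op_monom_deriv assms(1,1), of k c 0] by simp_all

text \<open>Both sides are additive in \<open>p\<close> and in \<open>q\<close>, which reduces the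
  claim to single terms; there the multi-indices add, and \<open>monom_deriv_add\<close> applies.
  Additivity in \<open>q\<close> of the right-hand side rests on the linearity of the derivatives on
  smooth functions.\<close>

lemma mpoly_op_mult:
  assumes f: "f \<in> smooth_functions"
  shows "mpoly_op (p * q) f = mpoly_op p (mpoly_op q f)"
proof -
  have 1: "mpoly_op (single k c * q) f = mpoly_op (single k c) (mpoly_op q f)" for k c
  proof (induction q rule: poly_mapping_add_induct)
    case zero
    have "monom_deriv k (\<lambda>x. 0) = (\<lambda>x. 0)" using monom_deriv_linear(2)[OF smooth_zero smooth_zero, of k 0] by simp
    then show ?case by (simp add: mpoly_op_zero mpoly_op_single)
  next
    case (add l d q)
    have sm: "monom_deriv l f \<in> smooth_functions" by (rule smooth_opD(1)[OF smooth_op_monom_deriv f])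
    have "mpoly_op (single k c) (mpoly_op (single l d + q) f) =
        (\<lambda>x. c * (d * monom_deriv k (monom_deriv l f) x + monom_deriv k (mpoly_op q f) x))"
      unfolding mpoly_op_add mpoly_op_single
      unfolding monom_deriv_linear(1)[OF smooth_mult[OF sm] mpoly_op_smooth[OF f]]
        monom_deriv_linear(2)[OF sm sm] ..
    also have "\<dots> = (\<lambda>x. mpoly_op (single (k + l) (c * d)) f x + mpoly_op (single k c * q) f x)"
      unfolding mpoly_op_single add.IH by (simp add: monom_deriv_add[OF f] algebra_simps)
    finally show ?case by (simp add: distrib_left mult_single mpoly_op_add)
  qed
  show ?thesis
  proof (induction p rule: poly_mapping_add_induct)
    case (add k c p)
    then show ?case by (simp only: distrib_right mpoly_op_add 1)
  qed (simp add: mpoly_op_zero)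
qed

text \<open>The number \<open>m\<close> has to cover all variables of \<open>p\<close>, because
  derivatives of the exponential in further variables vanish and would falsify the
  eigenvalue.\<close>

lemma mpoly_op_exp_fun:
  assumes "\<And>k. k \<in> keys p \<Longrightarrow> bound k \<le> m"
  shows "mpoly_op p (\<lambda>x. c * exp_fun t m x) = (\<lambda>x. mpoly_eval t p * c * exp_fun t m x)"
proof
  fix x
  have "mpoly_op p (\<lambda>x. c * exp_fun t m x) x =
      (\<Sum>k\<in>keys p. lookup p k * ((\<Prod>i<bound k. t i ^ lookup k i) * c * exp_fun t m x))"
    unfolding mpoly_op_def monom_deriv_def using assms
    by (intro sum.cong refl) (simp add: mixed_deriv_exp_fun)
  also have "\<dots> = mpoly_eval t p * c * exp_fun t m x"
    unfolding mpoly_eval_def by (simp add: sum_distrib_right mult.assoc)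
  finally show "mpoly_op p (\<lambda>x. c * exp_fun t m x) x = mpoly_eval t p * c * exp_fun t m x" .
qed

lemma bound_le_exists:
  fixes p :: real_mpoly
  shows "\<exists>m. \<forall>k\<in>keys p. bound k \<le> m"
  using finite_keys[of p] by (meson finite_imageI finite_nat_set_iff_bounded_le imageI)

lemma mpoly_eval_zero [simp]: "mpoly_eval t 0 = 0"
  by (simp add: mpoly_eval_def)

lemma mpoly_eval_add: "mpoly_eval t (p + q) = mpoly_eval t p + mpoly_eval t q"
  unfolding mpoly_eval_def by (rule keys_sum_add)

text \<open>Multiplicativity of evaluation is read off from the operators: \<open>p * q\<close> is
  applied to an exponential directly and as a composition, and the results are compared at the
  origin, where the exponential is 1.\<close>

lemma mpoly_eval_mult: "mpoly_eval t (p * q) = mpoly_eval t p * mpoly_eval t q"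
proof -
  obtain a b c where "\<forall>k\<in>keys p. bound k \<le> a" "\<forall>k\<in>keys q. bound k \<le> b" "\<forall>k\<in>keys (p * q). bound k \<le> c"
    using bound_le_exists by metis
  then have m: "\<And>k. k \<in> keys p \<Longrightarrow> bound k \<le> max a (max b c)" "\<And>k. k \<in> keys q \<Longrightarrow> bound k \<le> max a (max b c)"
    "\<And>k. k \<in> keys (p * q) \<Longrightarrow> bound k \<le> max a (max b c)" by (auto simp: le_max_iff_disj)
  let ?e = "exp_fun t (max a (max b c))"
  have "(\<lambda>x. mpoly_eval t (p * q) * 1 * ?e x) = mpoly_op (p * q) (\<lambda>x. 1 * ?e x)"
    by (rule mpoly_op_exp_fun[OF m(3), symmetric])
  also have "\<dots> = mpoly_op p (mpoly_op q (\<lambda>x. 1 * ?e x))"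
    by (rule mpoly_op_mult[OF exp_fun_smooth])
  also have "mpoly_op q (\<lambda>x. 1 * ?e x) = (\<lambda>x. (mpoly_eval t q * 1) * ?e x)"
    by (rule mpoly_op_exp_fun[OF m(2)])
  also have "mpoly_op p \<dots> = (\<lambda>x. mpoly_eval t p * (mpoly_eval t q * 1) * ?e x)"
    by (rule mpoly_op_exp_fun[OF m(1)])
  finally have "mpoly_eval t (p * q) * 1 * ?e (\<lambda>_. 0) = mpoly_eval t p * (mpoly_eval t q * 1) * ?e (\<lambda>_. 0)"
    by (rule fun_cong)
  then show ?thesis by (simp add: exp_fun_def)
qed

lemma mpoly_eval_const [simp]: "mpoly_eval t (single 0 c) = c"
  by (simp add: mpoly_eval_def)

section \<open>Polynomials in the first n variables\<close>

definition mpoly_var :: "nat \<Rightarrow> real_mpoly" where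
  "mpoly_var n = single (single n 1) 1"

lemma mpoly_eval_var [simp]: "mpoly_eval t (mpoly_var n) = t n"
proof -
  \<comment> \<open>The strict bound of the multi-index \<open>single n 1\<close> is
    \<open>Suc n\<close>, and all exponents below \<open>n\<close> are 0.\<close>
  have "(\<Prod>i<Suc n. t i ^ lookup (single n (1::nat)) i) = t n"
    by (subst prod.lessThan_Suc) (simp add: lookup_single)
  then show ?thesis by (simp add: mpoly_eval_def mpoly_var_def)
qed

lemma mpoly_eval_poly:
  "mpoly_eval t (poly P a) = poly (map_poly (mpoly_eval t) P) (mpoly_eval t a)"
  by (induction P) (simp_all add: mpoly_eval_add mpoly_eval_mult map_poly_pCons)

text \<open>Variables are adjoined one at a time. Substituting \<open>mpoly_var n\<close> brings the
  univariate polynomials over \<open>mpolys n\<close> back into the type \<open>real_mpoly\<close>,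
  so that recursion on the number of variables stays within one type.\<close>

primrec mpolys :: "nat \<Rightarrow> real_mpoly set" where
  "mpolys 0 = range (single 0)"
| "mpolys (Suc n) = (\<lambda>P. poly P (mpoly_var n)) ` polys_over (mpolys n)"

lemma idom_subring_mpolys: "idom_subring (mpolys n)"
proof (induction n)
  case 0
  show ?case
  proof
    show "1 \<in> mpolys 0" by (metis mpolys.simps(1) rangeI single_one)
    fix a b :: real_mpoly assume "a \<in> mpolys 0" "b \<in> mpolys 0"
    then show "a + b \<in> mpolys 0" "- a \<in> mpolys 0" "a * b \<in> mpolys 0"
      by (auto simp: mult_single simp flip: single_add single_uminus)
  qed
next
  case (Suc n)
  interpret S: idom_subring "polys_over (mpolys n)"
    using Suc by (rule idom_subring.idom_subring_polys_over)
  show ?case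
  proof
    show "1 \<in> mpolys (Suc n)" by (auto intro: image_eqI[of _ _ 1])
    fix a b :: real_mpoly assume "a \<in> mpolys (Suc n)" "b \<in> mpolys (Suc n)"
    then show "a + b \<in> mpolys (Suc n)" "- a \<in> mpolys (Suc n)" "a * b \<in> mpolys (Suc n)"
      by (auto simp flip: poly_add poly_minus poly_mult)
  qed
qed

lemma mpolys_mono: "m \<le> n \<Longrightarrow> mpolys m \<subseteq> mpolys n"
proof (induction n rule: dec_induct)
  case (step n)
  interpret S: idom_subring "mpolys n" by (rule idom_subring_mpolys)
  have "p \<in> mpolys (Suc n)" if "p \<in> mpolys n" for p
    using that by (auto intro: image_eqI[of _ _ "[:p:]"])
  with step show ?case by blast
qed simp

lemma mpoly_var_mpolys: "mpoly_var n \<in> mpolys (Suc n)"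
proof -
  interpret S: idom_subring "mpolys n" by (rule idom_subring_mpolys)
  have "[:0, 1:] \<in> polys_over (mpolys n)"
    by (auto simp: polys_over_def coeff_pCons split: nat.splits)
  then show ?thesis by (auto intro: image_eqI[of _ _ "[:0, 1:]"])
qed

lemma mpolys_closed2:
  assumes "\<exists>n. p \<in> mpolys n" "\<exists>n. q \<in> mpolys n"
  shows "\<exists>n. p + q \<in> mpolys n" "\<exists>n. p * q \<in> mpolys n"
proof -
  from assms obtain m n where "p \<in> mpolys m" "q \<in> mpolys n" by blast
  then have "p \<in> mpolys (max m n)" "q \<in> mpolys (max m n)"
    using mpolys_mono[of m "max m n"] mpolys_mono[of n "max m n"] by auto
  with idom_subring.add_closed[OF idom_subring_mpolys] idom_subring.mult_closed[OF idom_subring_mpolys]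
  show "\<exists>n. p + q \<in> mpolys n" "\<exists>n. p * q \<in> mpolys n" by blast+
qed

lemma ex_mpolys: "\<exists>n. p \<in> mpolys n"
proof (induction p rule: poly_mapping_add_induct)
  case zero
  show ?case by (intro exI[of _ 0]) (auto intro: range_eqI[of _ _ 0])
next
  case (add k c p)
  have var: "\<exists>n. single (single i a) 1 \<in> mpolys n" for i a
  proof (induction a)
    case 0
    show ?case using idom_subring.one_closed[OF idom_subring_mpolys] by auto
  next
    case (Suc a)
    have "single (single i (Suc a)) 1 = mpoly_var i * single (single i a) (1::real)"
      by (simp add: mpoly_var_def mult_single flip: single_add)
    then show ?case using mpolys_closed2(2)[OF _ Suc] mpoly_var_mpolys by metis
  qed
  have "\<exists>n. single k c \<in> mpolys n"
  proof (induction k rule: poly_mapping_add_induct)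
    case zero
    show ?case by (intro exI[of _ 0]) auto
  next
    case (add i a k)
    have "single (single i a + k) c = single (single i a) 1 * single k c" by (simp add: mult_single)
    then show ?case using mpolys_closed2(2)[OF var add] by metis
  qed
  then show ?case using mpolys_closed2(1) add by blast
qed

lemma mpoly_eval_cong:
  assumes "p \<in> mpolys n" "\<And>i. i < n \<Longrightarrow> s i = t i"
  shows "mpoly_eval s p = mpoly_eval t p"
  using assms
proof (induction n arbitrary: p)
  case (Suc n)
  then obtain P where P: "P \<in> polys_over (mpolys n)" "p = poly P (mpoly_var n)" by auto
  have "map_poly (mpoly_eval s) P = map_poly (mpoly_eval t) P"
    using Suc P(1) by (intro poly_eqI) (auto simp: coeff_map_poly polys_over_def)
  then show ?case using Suc.prems by (simp add: P mpoly_eval_poly)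
qed auto

text \<open>With \<open>t\<close> fixed, varying coordinate \<open>n\<close> does not change the
  values of the coefficients, so the real polynomial formed from these values vanishes everywhere
  and is 0. As \<open>t\<close> is arbitrary, each coefficient has only zero values. The first
  premise is the induction hypothesis in \<open>mpolys_eval_eq_0\<close>; the lemma also yields
  injectivity of the substitution.\<close>

lemma poly_mpoly_eq_0:
  assumes "\<And>p. p \<in> mpolys n \<Longrightarrow> \<forall>t. mpoly_eval t p = 0 \<Longrightarrow> p = 0"
    and "P \<in> polys_over (mpolys n)" and "\<forall>t. mpoly_eval t (poly P (mpoly_var n)) = 0"
  shows "P = 0"
proof (rule poly_eqI)
  fix i
  have c: "coeff P j \<in> mpolys n" for j using assms(2) by (simp add: polys_over_def)
  have "mpoly_eval t (coeff P i) = 0" for t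
  proof -
    let ?Q = "map_poly (mpoly_eval t) P"
    have "poly ?Q s = 0" for s
    proof -
      have "map_poly (mpoly_eval (t(n := s))) P = ?Q"
        by (rule poly_eqI) (use mpoly_eval_cong[OF c, of "t(n := s)" t] in \<open>simp add: coeff_map_poly\<close>)
      with assms(3)[rule_format, of "t(n := s)"] show ?thesis by (simp add: mpoly_eval_poly)
    qed
    then have "?Q = 0" using poly_all_0_iff_0 by blast
    then have "coeff ?Q i = 0" by simp
    then show ?thesis by (simp add: coeff_map_poly)
  qed
  then show "coeff P i = coeff 0 i" using assms(1)[OF c] by simp
qed

lemma mpolys_eval_eq_0:
  assumes "p \<in> mpolys n" "\<forall>t. mpoly_eval t p = 0"
  shows "p = 0"
  using assms
proof (induction n arbitrary: p)
  case (Suc n)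
  then obtain P where "P \<in> polys_over (mpolys n)" "p = poly P (mpoly_var n)" by auto
  with Suc poly_mpoly_eq_0[of n P] show ?case by simp
qed auto

text \<open>The constants form a field, where every nonzero element is a unit. The step adjoins a
  variable formally and transports the factorizations along the substitution of
  \<open>mpoly_var n\<close>.\<close>

lemma ufd_on_mpolys: "ufd_on (mpolys n)"
proof (induction n)
  case 0
  show ?case unfolding ufd_on_def
  proof (intro ballI impI)
    fix p assume p: "p \<in> mpolys 0" "p \<noteq> 0"
    then obtain c where c: "p = single 0 c" by auto
    with p have "c \<noteq> 0" by auto
    with c have "1 = p * single 0 (1 / c)" by (simp add: mult_single)
    then show "p \<in> prime_products (mpolys 0)"
      using p by (intro prime_products.unit dvd_inI) auto
  qed
next
  case (Suc n)
  interpret S: idom_subring "mpolys n" by (rule idom_subring_mpolys)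
  interpret P: idom_subring "polys_over (mpolys n)" by (rule S.idom_subring_polys_over)
  have "inj_on (\<lambda>P. poly P (mpoly_var n)) (polys_over (mpolys n))"
  proof (rule inj_onI)
    fix P Q assume "P \<in> polys_over (mpolys n)" "Q \<in> polys_over (mpolys n)"
      "poly P (mpoly_var n) = poly Q (mpoly_var n)"
    then have "P - Q = 0" by (intro poly_mpoly_eq_0[OF mpolys_eval_eq_0]) auto
    then show "P = Q" by simp
  qed
  from P.ufd_on_image[OF S.ufd_on_polys_over[OF Suc] this] show ?case by simp
qed

lemma mpoly_refinement:
  fixes a b c d :: real_mpoly
  assumes "a * b = c * d"
  shows "\<exists>e f g h. a = e * f \<and> b = g * h \<and> c = e * g \<and> d = f * h"
proof (cases "a = 0")
  case True
  then consider "c = 0" | "d = 0" using assms by auto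
  then show ?thesis
  proof cases
    case 1
    \<comment> \<open>The zero goes into the part shared by \<open>a\<close> and \<open>c\<close>;
      the remaining parts only have to produce \<open>b\<close> and \<open>d\<close>.\<close>
    with True show ?thesis by (intro exI[of _ 0] exI[of _ d] exI[of _ b] exI[of _ 1]) simp
  next
    case 2
    with True show ?thesis by (intro exI[of _ c] exI[of _ 0] exI[of _ 1] exI[of _ b]) simp
  qed
next
  case False
  obtain i j k l where "a \<in> mpolys i" "b \<in> mpolys j" "c \<in> mpolys k" "d \<in> mpolys l"
    using ex_mpolys by metis
  then have m: "a \<in> mpolys (i + j + k + l)" "b \<in> mpolys (i + j + k + l)"
    "c \<in> mpolys (i + j + k + l)" "d \<in> mpolys (i + j + k + l)"
    by (auto intro: mpolys_mono[THEN subsetD, rotated])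
  interpret S: idom_subring "mpolys (i + j + k + l)" by (rule idom_subring_mpolys)
  have "a \<in> prime_products (mpolys (i + j + k + l))"
    using ufd_on_mpolys False m by (auto simp: ufd_on_def)
  from S.prime_products_refinement[OF this m(2-4) assms] show ?thesis by blast
qed

text \<open>Comparing the action on exponentials shows that \<open>p\<close> and \<open>q\<close>
  have the same value at every \<open>t\<close>, and a polynomial with only zero values is
  0.\<close>

lemma mpoly_op_inj:
  assumes "\<And>f. f \<in> smooth_functions \<Longrightarrow> mpoly_op p f = mpoly_op q f"
  shows "p = q"
proof -
  obtain n where n: "p - q \<in> mpolys n" using ex_mpolys by blast
  have "mpoly_eval t (p - q) = 0" for t
  proof -
    obtain a b where "\<forall>k\<in>keys p. bound k \<le> a" "\<forall>k\<in>keys q. bound k \<le> b"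
      using bound_le_exists by metis
    then have m: "\<And>k. k \<in> keys p \<Longrightarrow> bound k \<le> max a b" "\<And>k. k \<in> keys q \<Longrightarrow> bound k \<le> max a b"
      by (auto simp: le_max_iff_disj)
    have "(\<lambda>x. mpoly_eval t p * 1 * exp_fun t (max a b) x) = (\<lambda>x. mpoly_eval t q * 1 * exp_fun t (max a b) x)"
      using assms[OF exp_fun_smooth] mpoly_op_exp_fun[OF m(1)] mpoly_op_exp_fun[OF m(2)] by metis
    from fun_cong[OF this, of "\<lambda>_. 0"] have "mpoly_eval t p = mpoly_eval t q"
      by (simp add: exp_fun_def)
    moreover have "mpoly_eval t p = mpoly_eval t (p - q) + mpoly_eval t q"
      using mpoly_eval_add[of t "p - q" q] by simp
    ultimately show ?thesis by simp
  qed
  then have "p - q = 0" using mpolys_eval_eq_0[OF n] by blast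
  then show ?thesis by simp
qed

section \<open>Identification of the differential operators with polynomials\<close>

definition mpoly_diff_op :: "real_mpoly \<Rightarrow> real_fun \<Rightarrow> real_fun" where
  "mpoly_diff_op p = (\<lambda>f\<in>smooth_functions. mpoly_op p f)"

text \<open>Translates coefficients indexed by plain functions into coefficients indexed by finitely
  supported ones; the sums match because \<open>lookup\<close> is injective.\<close>

lemma diff_operator_eq:
  assumes "\<And>k. a (lookup k) = lookup p k" "{\<alpha>. a \<alpha> \<noteq> 0} = lookup ` keys p"
    "{\<alpha>. a \<alpha> \<noteq> 0} \<subseteq> multi_indices n"
  shows "diff_operator n a = mpoly_diff_op p"
proof -
  have inj: "inj_on lookup (keys p)" by (auto intro: inj_onI poly_mapping_eqI)
  have "(\<Sum>\<alpha> | a \<alpha> \<noteq> 0. a \<alpha> * mixed_deriv n \<alpha> f x) = mpoly_op p f x" for f x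
  proof -
    have "mixed_deriv n (lookup k) = monom_deriv k" if "k \<in> keys p" for k
      using that assms(2,3) by (intro monom_deriv_eq[symmetric]) (auto simp: multi_indices_def)
    then show ?thesis
      unfolding assms(2) mpoly_op_def by (simp add: sum.reindex[OF inj] assms(1))
  qed
  then show ?thesis by (simp add: diff_operator_def mpoly_diff_op_def)
qed

lemma diff_operators_eq: "diff_operators = range mpoly_diff_op"
proof (intro equalityI subsetI)
  fix D assume "D \<in> diff_operators"
  then obtain n a where D: "D = diff_operator n a" and fin: "finite {\<alpha>. a \<alpha> \<noteq> 0}"
    and sub: "{\<alpha>. a \<alpha> \<noteq> 0} \<subseteq> multi_indices n" by (auto simp: diff_operators_def)
  have inj: "inj lookup" by (auto intro: injI poly_mapping_eqI)
  define p where "p = Abs_poly_mapping (\<lambda>k. a (lookup k))"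
  have "finite {k. a (lookup k) \<noteq> 0}"
    using finite_vimageI[OF fin inj] by (simp add: vimage_def)
  then have p: "lookup p = (\<lambda>k. a (lookup k))" by (simp add: p_def)
  have "\<alpha> \<in> lookup ` keys p" if "a \<alpha> \<noteq> 0" for \<alpha>
  proof -
    \<comment> \<open>An index in the support vanishes from \<open>n\<close> on, so it is finitely
      supported and lies in the range of \<open>lookup\<close>.\<close>
    have "{i. \<alpha> i \<noteq> 0} \<subseteq> {..<n}" using that sub by (force simp: multi_indices_def not_less[symmetric])
    then have "finite {i. \<alpha> i \<noteq> 0}" using finite_subset by blast
    then have "\<alpha> = lookup (Abs_poly_mapping \<alpha>)" by simp
    with that show ?thesis by (metis image_eqI in_keys_iff p)
  qed
  then have "{\<alpha>. a \<alpha> \<noteq> 0} = lookup ` keys p" by (auto simp: in_keys_iff p)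
  with D sub show "D \<in> range mpoly_diff_op" using diff_operator_eq[of a p n] p by auto
next
  fix D assume "D \<in> range mpoly_diff_op"
  then obtain p where D: "D = mpoly_diff_op p" by blast
  obtain n where n: "\<forall>k\<in>keys p. bound k \<le> n" using bound_le_exists by blast
  \<comment> \<open>\<open>Abs_poly_mapping\<close> inverts \<open>lookup\<close> only on finitely
    supported functions; all other indices receive the coefficient 0.\<close>
  define a where "a \<alpha> = (if finite {i. \<alpha> i \<noteq> 0} then lookup p (Abs_poly_mapping \<alpha>) else 0)" for \<alpha>
  have a: "a (lookup k) = lookup p k" for k by (simp add: a_def Poly_Mapping.lookup_inverse)
  have "\<alpha> \<in> lookup ` keys p" if "a \<alpha> \<noteq> 0" for \<alpha>
  proof -
    have "\<alpha> = lookup (Abs_poly_mapping \<alpha>)" "Abs_poly_mapping \<alpha> \<in> keys p"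
      using that by (auto simp: a_def in_keys_iff split: if_splits)
    then show ?thesis by blast
  qed
  then have supp: "{\<alpha>. a \<alpha> \<noteq> 0} = lookup ` keys p" by (auto simp: a in_keys_iff)
  have sub: "{\<alpha>. a \<alpha> \<noteq> 0} \<subseteq> multi_indices n"
    unfolding supp using n by (auto simp: multi_indices_def intro!: beyond_degree_lookup_zero)
  have "D = diff_operator n a" using D diff_operator_eq[OF a supp sub] by simp
  moreover have "finite {\<alpha>. a \<alpha> \<noteq> 0}" unfolding supp by simp
  ultimately show "D \<in> diff_operators" using sub by (auto simp: diff_operators_def)
qed

lemma mpoly_diff_op_mult:
  "compose smooth_functions (mpoly_diff_op p) (mpoly_diff_op q) = mpoly_diff_op (p * q)"
  by (auto simp: compose_def mpoly_diff_op_def mpoly_op_mult mpoly_op_smooth fun_eq_iff)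

lemma mpoly_diff_op_one: "mpoly_diff_op 1 = (\<lambda>f\<in>smooth_functions. f)"
proof -
  have "mpoly_op 1 f = f" for f
    using mpoly_op_single[of 0 1 f] by (simp add: monom_deriv_def)
  then show ?thesis by (simp add: mpoly_diff_op_def)
qed

lemma mpoly_diff_op_inj:
  assumes "mpoly_diff_op p = mpoly_diff_op q"
  shows "p = q"
proof (rule mpoly_op_inj)
  show "mpoly_op p f = mpoly_op q f" if "f \<in> smooth_functions" for f
    using fun_cong[OF assms, of f] that by (simp add: mpoly_diff_op_def)
qed

theorem theorem4p2:
  "monoid diff_operator_monoid \<and> additive_splitting diff_operator_monoid"
proof
  \<comment> \<open>Composition corresponds to multiplication of polynomials, so the monoid laws are
    inherited from there.\<close>
  show "monoid diff_operator_monoid"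
    by (rule monoidI) (auto simp: diff_operator_monoid_def diff_operators_eq mpoly_diff_op_mult
        mult.assoc simp flip: mpoly_diff_op_one)
  \<comment> \<open>Injectivity turns equal compositions into equal products of polynomials, which
    are then refined.\<close>
  have "\<exists>e f g h. mpoly_diff_op a = mpoly_diff_op (e * f) \<and> mpoly_diff_op b = mpoly_diff_op (g * h) \<and>
      mpoly_diff_op c = mpoly_diff_op (e * g) \<and> mpoly_diff_op d = mpoly_diff_op (f * h)"
    if "mpoly_diff_op (a * b) = mpoly_diff_op (c * d)" for a b c d
    using mpoly_refinement[OF mpoly_diff_op_inj[OF that]] by metis
  then show "additive_splitting diff_operator_monoid"
    by (simp add: additive_splitting_def diff_operator_monoid_def diff_operators_eq mpoly_diff_op_mult)
qed

end
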